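(* Let $H$ be a complex Hilbert space and let $A,B\in B(H)$ be such that $AB=BA$. If $A$ is normal and $B$ is hyponormal, then $|A+B|\leq |A|+|B|$.
   Context: $B(H)$ denotes the algebra of bounded linear operators on $H$. An operator $T\in B(H)$ is positive, $T\geq 0$, if $\langle Tx,x\rangle\geq 0$ for all $x\in H$; for self-adjoint $S,T$, $S\leq T$ means $T-S\geq 0$. For $T\in B(H)$, $|T|=\sqrt{T^*T}$ denotes the absolute value (modulus) of $T$, i.e. the unique positive square root of $T^*T$. An operator $T$ is normal if $TT^*=T^*T$, and hyponormal if $TT^*\leq T^*T$, equivalently $\|T^*x\|\leq\|Tx\|$ for all $x\in H$. *)

theory Defs
  imports "HOL-Analysis.Analysis"
begin

class complex_vector = real_vector +
  fixes scaleC :: "complex \<Rightarrow> 'a \<Rightarrow> 'a"  (infixr "*\<^sub>C" 75)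
  assumes scaleC_add_right: "c *\<^sub>C (x + y) = c *\<^sub>C x + c *\<^sub>C y"
    and scaleC_add_left: "(c + d) *\<^sub>C x = c *\<^sub>C x + d *\<^sub>C x"
    and scaleC_scaleC: "c *\<^sub>C d *\<^sub>C x = (c * d) *\<^sub>C x"
    and scaleC_one: "1 *\<^sub>C x = x"
    and scaleR_scaleC: "r *\<^sub>R x = complex_of_real r *\<^sub>C x"

text \<open>
  The complex inner product is linear in its first argument. Its positive definiteness and
  the norm it induces come from the real inner product of the class real_inner, which is
  required to be its real part; see \<open>cinner_self\<close> and \<open>cinner_self_eq_0_iff\<close>.
\<close>

class complex_inner = complex_vector + real_inner +
  fixes cinner :: "'a \<Rightarrow> 'a \<Rightarrow> complex"
  assumes cinner_commute: "cinner x y = cnj (cinner y x)"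
    and cinner_add_left: "cinner (x + y) z = cinner x z + cinner y z"
    and cinner_scaleC_left: "cinner (c *\<^sub>C x) y = c * cinner x y"
    and inner_eq_Re_cinner: "inner x y = Re (cinner x y)"

class chilbert_space = complex_inner + complete_space

lemma cinner_self: "cinner x x = complex_of_real ((norm x)\<^sup>2)"
  for x :: "'a::complex_inner"
proof (rule complex_eqI)
  show "Re (cinner x x) = Re (complex_of_real ((norm x)\<^sup>2))"
    by (simp add: power2_norm_eq_inner inner_eq_Re_cinner)
  have "cinner x x = cnj (cinner x x)"
    by (rule cinner_commute)
  then have "Im (cinner x x) = - Im (cinner x x)"
    by (metis cnj.simps(2))
  then show "Im (cinner x x) = Im (complex_of_real ((norm x)\<^sup>2))"
    by simp
qed

lemma cinner_self_eq_0_iff: "cinner x x = 0 \<longleftrightarrow> x = 0"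
  for x :: "'a::complex_inner"
  by (simp add: cinner_self)

instantiation complex :: chilbert_space
begin

definition scaleC_complex :: "complex \<Rightarrow> complex \<Rightarrow> complex"
  where "scaleC_complex c x = c * x"

definition cinner_complex :: "complex \<Rightarrow> complex \<Rightarrow> complex"
  where "cinner_complex x y = x * cnj y"

instance
  by standard
    (auto simp: scaleC_complex_def cinner_complex_def algebra_simps scaleR_conv_of_real
      inner_complex_def)

end

text \<open>
  The type of bounded linear maps of the library is that of real-linear maps, so the
  algebra B(H) consists of its complex-homogeneous elements.
\<close>

definition bounded_ops :: "('h::chilbert_space \<Rightarrow>\<^sub>L 'h) set"
  where "bounded_ops = {T. \<forall>c x. blinfun_apply T (c *\<^sub>C x) = c *\<^sub>C blinfun_apply T x}"

text \<open>
  The adjoint with respect to the complex inner product, which exists uniquely for T in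
  B(H). (The library constant adjoint refers to the real inner product.)
\<close>

definition op_adj :: "('h::chilbert_space \<Rightarrow>\<^sub>L 'h) \<Rightarrow> ('h \<Rightarrow>\<^sub>L 'h)"
  where "op_adj T = (THE S. S \<in> bounded_ops \<and>
    (\<forall>x y. cinner (blinfun_apply T x) y = cinner x (blinfun_apply S y)))"

definition op_positive :: "('h::chilbert_space \<Rightarrow>\<^sub>L 'h) \<Rightarrow> bool"
  where "op_positive T \<longleftrightarrow>
    T \<in> bounded_ops \<and> (\<forall>x. cinner (blinfun_apply T x) x \<in> \<real>\<^sub>\<ge>\<^sub>0)"

text \<open>
  The order is only meant for self-adjoint operators; every use below is of that kind.
\<close>

definition op_le :: "('h::chilbert_space \<Rightarrow>\<^sub>L 'h) \<Rightarrow> ('h \<Rightarrow>\<^sub>L 'h) \<Rightarrow> bool"  (infix "\<le>\<^sub>o\<^sub>p" 50)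
  where "S \<le>\<^sub>o\<^sub>p T \<longleftrightarrow> op_positive (T - S)"

definition op_abs :: "('h::chilbert_space \<Rightarrow>\<^sub>L 'h) \<Rightarrow> ('h \<Rightarrow>\<^sub>L 'h)"
  where "op_abs T = (THE S. op_positive S \<and> S o\<^sub>L S = op_adj T o\<^sub>L T)"

definition op_normal :: "('h::chilbert_space \<Rightarrow>\<^sub>L 'h) \<Rightarrow> bool"
  where "op_normal T \<longleftrightarrow> T o\<^sub>L op_adj T = op_adj T o\<^sub>L T"

definition op_hyponormal :: "('h::chilbert_space \<Rightarrow>\<^sub>L 'h) \<Rightarrow> bool"
  where "op_hyponormal T \<longleftrightarrow> T o\<^sub>L op_adj T \<le>\<^sub>o\<^sub>p op_adj T o\<^sub>L T"

end

theory Submission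
  imports Defs "HOL-Complex_Analysis.Complex_Analysis"
begin

text \<open>
  The idea is to compare squares. Writing \<open>P = |A|\<close> and \<open>Q = |B|\<close>, the inequality to aim for is
  \<open>\<parallel>(A + B) x\<parallel> \<le> \<parallel>(P + Q) x\<parallel>\<close> for all \<open>x\<close>, that is \<open>|A + B|\<^sup>2 \<le> (P + Q)\<^sup>2\<close>; taking square roots
  preserves the operator order. Since \<open>\<parallel>A x\<parallel> = \<parallel>P x\<parallel>\<close> and \<open>\<parallel>B x\<parallel> = \<parallel>Q x\<parallel>\<close>, only the cross terms
  matter, and the claim becomes \<open>Re \<langle>A x, B x\<rangle> \<le> \<langle>P x, Q x\<rangle>\<close>. By Fuglede's theorem \<open>A\<^sup>*\<close>
  commutes with \<open>B\<close> as well, so \<open>P\<close> commutes with \<open>B\<close>, with \<open>B\<^sup>*\<close> and hence with \<open>Q\<close>, and \<open>P Q\<close> is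
  positive. The operator \<open>T = A\<^sup>* B\<close> satisfies \<open>\<parallel>T\<^sup>* x\<parallel> \<le> \<parallel>T x\<parallel> = \<parallel>P Q x\<parallel>\<close>, because \<open>B\<close> is
  hyponormal and \<open>A\<close> is normal. Its real part \<open>H = (T + T\<^sup>*) / 2\<close> therefore satisfies
  \<open>\<parallel>H x\<parallel> \<le> \<parallel>P Q x\<parallel>\<close>, and this already gives \<open>H \<le> P Q\<close>, which is the cross term inequality.

  Both passages from norms to the operator order are instances of one lemma,
  \<open>inner_le_if_norm_le\<close>: if \<open>H\<close> is self-adjoint, \<open>R\<close> is positive and \<open>\<parallel>H x\<parallel> \<le> \<parallel>R x\<parallel>\<close> for all \<open>x\<close>,
  then \<open>H \<le> R\<close>. It is proved with an approximate eigenvector at the top of the numerical range of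
  \<open>H - R\<close>, without any functional calculus, and it also shows that positive square roots are unique.

  The remaining ingredients are norm convergent power series in an operator. The binomial series
  of \<open>sqrt (1 - t)\<close> produces positive square roots that commute with everything commuting with the
  given operator (\<open>positive_square_root_exists\<close>). The exponential series carries Rosenblum's proof
  of Fuglede's theorem: the entire function \<open>exp (z A\<^sup>*) B exp (- z A\<^sup>*)\<close> is bounded, and
  Liouville's theorem makes its linear coefficient \<open>A\<^sup>* B - B A\<^sup>*\<close> vanish (\<open>fuglede\<close>).

  Most arguments use only the real inner product, which determines the adjoint of a
  complex-linear operator.
\<close>

section \<open>Riesz representation, adjoints and positivity\<close>

text \<open>
  The representing vector minimizes \<open>\<parallel>x\<parallel>\<^sup>2 - 2 f x\<close>. By the parallelogram law every minimizing
  sequence is Cauchy, and the first-order condition at the minimum says that \<open>f\<close> is the inner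
  product with the minimizer.
\<close>

lemma riesz_representation:
  fixes f :: "'a::{real_inner, complete_space} \<Rightarrow>\<^sub>L real"
  shows "\<exists>u. \<forall>x. f x = x \<bullet> u"
proof -
  define g where "g x = (norm x)\<^sup>2 - 2 * f x" for x :: 'a
  have lower: "- (norm f)\<^sup>2 \<le> g x" for x
  proof -
    have "f x \<le> norm f * norm x"
      using norm_blinfun[of f x] by simp
    moreover have "0 \<le> (norm x - norm f)\<^sup>2"
      by simp
    ultimately show ?thesis
      unfolding g_def power2_diff by (simp add: algebra_simps)
  qed
  define m where "m = Inf (range g)"
  have bdd: "bdd_below (range g)"
    using lower by (intro bdd_belowI[of _ "- (norm f)\<^sup>2"]) auto
  have m_le: "m \<le> g x" for x
    unfolding m_def by (rule cInf_lower) (auto intro: bdd)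
  have "\<exists>x. g x < m + 1 / Suc n" for n
    using cInf_lessD[of "range g" "m + 1 / Suc n"] by (auto simp: m_def)
  then obtain x where x: "\<And>n. g (x n) < m + 1 / Suc n"
    by metis
  have dist_le: "(norm (y - z))\<^sup>2 \<le> 2 * g y + 2 * g z - 4 * m" for y z
  proof -
    have "(norm (y - z))\<^sup>2 = 2 * g y + 2 * g z - 4 * g ((1/2) *\<^sub>R (y + z))"
      by (simp add: g_def power2_norm_eq_inner inner_simps blinfun.bilinear_simps
          inner_commute algebra_simps)
    then show ?thesis
      using m_le[of "(1/2) *\<^sub>R (y + z)"] by simp
  qed
  have "Cauchy x"
  proof (rule metric_CauchyI)
    fix e :: real assume e: "0 < e"
    then obtain N where N: "4 / Suc N < e\<^sup>2"
      using reals_Archimedean[of "e\<^sup>2 / 4"] by (auto simp: field_simps)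
    have "dist (x i) (x j) < e" if "i \<ge> N" "j \<ge> N" for i j
    proof -
      have "1 / Suc i \<le> 1 / Suc N" "1 / Suc j \<le> 1 / Suc N"
        using that by (auto simp: field_simps)
      then have "(norm (x i - x j))\<^sup>2 < e\<^sup>2"
        using dist_le[of "x i" "x j"] x[of i] x[of j] N by simp
      then show ?thesis
        using e by (simp add: dist_norm power_less_imp_less_base)
    qed
    then show "\<exists>M. \<forall>m\<ge>M. \<forall>n\<ge>M. dist (x m) (x n) < e"
      by blast
  qed
  then obtain u where u: "x \<longlonglongrightarrow> u"
    using Cauchy_convergent convergent_def by blast
  have "(\<lambda>n. g (x n)) \<longlonglongrightarrow> g u"
    unfolding g_def by (intro tendsto_intros u)
  moreover have "(\<lambda>n. m + 1 / Suc n) \<longlonglongrightarrow> m + 0"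
    by (intro tendsto_add tendsto_const LIMSEQ_Suc[OF lim_1_over_n])
  ultimately have "g u \<le> m + 0"
    using x by (intro LIMSEQ_le[of "\<lambda>n. g (x n)" _ "\<lambda>n. m + 1 / Suc n"]) (auto intro: less_imp_le)
  then have min: "g u \<le> g v" for v
    using m_le[of v] by simp
  have "f v = v \<bullet> u" for v
  proof (rule ccontr)
    define d where "d = v \<bullet> u - f v"
    assume "f v \<noteq> v \<bullet> u"
    then have d: "d \<noteq> 0" and v: "v \<noteq> 0"
      by (auto simp: d_def blinfun.bilinear_simps)
    \<comment> \<open>This \<open>t\<close> minimizes the quadratic polynomial \<open>g (u + t v)\<close>.\<close>
    define t where "t = - d / (v \<bullet> v)"
    have "g (u + t *\<^sub>R v) = g u + 2 * t * d + t\<^sup>2 * (v \<bullet> v)"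
      unfolding g_def d_def power2_norm_eq_inner
      by (simp add: inner_simps blinfun.bilinear_simps
          inner_commute algebra_simps power2_eq_square)
    also have "\<dots> = g u - d\<^sup>2 / (v \<bullet> v)"
      using v by (simp add: t_def field_simps power2_eq_square)
    finally show False
      using min[of "u + t *\<^sub>R v"] d v inner_gt_zero_iff[of v]
      by (simp add: zero_less_divide_iff flip: not_less)
  qed
  then show ?thesis by blast
qed

lemma cinner_scaleC_right: "cinner x (c *\<^sub>C y) = cnj c * cinner x y"
  by (metis cinner_scaleC_left cinner_commute complex_cnj_mult)

lemma norm_scaleC: "norm (c *\<^sub>C x) = cmod c * norm x" for x :: "'a::complex_inner"
proof -
  have "complex_of_real ((norm (c *\<^sub>C x))\<^sup>2) = (c * cnj c) * complex_of_real ((norm x)\<^sup>2)"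
    unfolding cinner_self[symmetric] cinner_scaleC_left cinner_scaleC_right
    by (simp only: mult_ac)
  also have "\<dots> = complex_of_real ((cmod c * norm x)\<^sup>2)"
    unfolding complex_norm_square[symmetric] power_mult_distrib by (rule of_real_mult[symmetric])
  finally have "complex_of_real ((norm (c *\<^sub>C x))\<^sup>2) = complex_of_real ((cmod c * norm x)\<^sup>2)" .
  then have "(norm (c *\<^sub>C x))\<^sup>2 = (cmod c * norm x)\<^sup>2"
    using of_real_eq_iff by blast
  then show ?thesis
    by (simp add: power2_eq_iff_nonneg)
qed

lemma cinner_eq_inner: "cinner x y = Complex (x \<bullet> y) (x \<bullet> (\<i> *\<^sub>C y))"
  by (simp add: complex_eq_iff inner_eq_Re_cinner cinner_scaleC_right)

lemma inner_scaleC_left: "(c *\<^sub>C x) \<bullet> y = x \<bullet> (cnj c *\<^sub>C y)"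
  for x :: "'a::complex_inner"
  by (simp only: inner_eq_Re_cinner cinner_scaleC_left cinner_scaleC_right complex_cnj_cnj)

lemma norm_cinner_le: "cmod (cinner x y) \<le> norm x * norm y"
proof (cases "cinner x y = 0")
  case False
  define w where "w = cinner x y"
  have w: "cmod w \<noteq> 0" using False by (simp add: w_def)
  \<comment> \<open>A unimodular factor makes the inner product real.\<close>
  define u where "u = cnj w / cmod w"
  have "cinner (u *\<^sub>C x) y = (w * cnj w) / cmod w"
    by (simp add: cinner_scaleC_left u_def w_def)
  also have "\<dots> = complex_of_real (cmod w)"
    unfolding complex_norm_square[symmetric] using w by (simp add: power2_eq_square)
  finally have "cmod w = (u *\<^sub>C x) \<bullet> y"
    by (simp add: inner_eq_Re_cinner)
  also have "\<dots> \<le> norm (u *\<^sub>C x) * norm y"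
    by (rule norm_cauchy_schwarz)
  also have "cmod u = 1"
    using w by (simp add: u_def norm_divide)
  then have "norm (u *\<^sub>C x) * norm y = norm x * norm y"
    by (simp add: norm_scaleC)
  finally show ?thesis by (simp add: w_def)
qed simp

lemma cinner_scaleR_left: "cinner (r *\<^sub>R x) y = r *\<^sub>R cinner x y"
  by (subst scaleR_scaleC) (simp add: cinner_scaleC_left scaleR_conv_of_real)

lemma bounded_linear_cinner_left: "bounded_linear (\<lambda>x. cinner x y)"
  by (rule bounded_linear_intro[where K = "norm y"])
    (simp_all add: cinner_add_left cinner_scaleR_left norm_cinner_le)

lemma eq_if_inner_eq: "(\<And>x. x \<bullet> y = x \<bullet> z) \<Longrightarrow> y = z" for y z :: "'a::real_inner"
  by (metis inner_commute vector_eq_rdot)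

lemma bounded_opsD: "T \<in> bounded_ops \<Longrightarrow> T (c *\<^sub>C x) = c *\<^sub>C T x"
  by (simp add: bounded_ops_def)

lemma real_adjoint_exists:
  fixes T :: "'a::{real_inner, complete_space} \<Rightarrow>\<^sub>L 'a"
  obtains S :: "'a \<Rightarrow>\<^sub>L 'a" where "\<And>x y. T x \<bullet> y = x \<bullet> S y"
proof -
  have "\<exists>u. \<forall>x. T x \<bullet> y = x \<bullet> u" for y
    using riesz_representation[of "blinfun_inner_left y o\<^sub>L T"]
    by (simp add: blinfun_inner_left.rep_eq)
  then obtain s where s: "\<And>x y. T x \<bullet> y = x \<bullet> s y"
    by metis
  have "bounded_linear s"
  proof (rule bounded_linear_intro[where K = "norm T"])
    show "s (x + y) = s x + s y" for x y
      by (rule eq_if_inner_eq) (simp add: inner_add_right flip: s)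
    show "s (r *\<^sub>R x) = r *\<^sub>R s x" for r x
      by (rule eq_if_inner_eq) (simp flip: s)
    show "norm (s x) \<le> norm x * norm T" for x
    proof -
      have "norm (s x) * norm (s x) = T (s x) \<bullet> x"
        by (simp add: s flip: power2_eq_square power2_norm_eq_inner)
      also have "\<dots> \<le> norm T * norm (s x) * norm x"
        by (meson norm_blinfun norm_cauchy_schwarz mult_right_mono norm_ge_zero order_trans)
      finally have "norm (s x) * norm (s x) \<le> norm (s x) * (norm x * norm T)"
        by (simp add: algebra_simps)
      then show ?thesis
        by (cases "s x = 0") auto
    qed
  qed
  then have "T x \<bullet> y = x \<bullet> Blinfun s y" for x y
    by (simp add: s bounded_linear_Blinfun_apply)
  then show thesis using that by blast
qed

text \<open>
  An adjoint for the real inner product of a complex-linear operator is itself complex-linear: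
  multiplication by \<open>c\<close> has multiplication by \<open>cnj c\<close> as its real adjoint. This is what allows the
  complex adjoint to be handled through the real inner product.
\<close>

lemma adjoint_in_bounded_ops:
  fixes S T :: "'h::chilbert_space \<Rightarrow>\<^sub>L 'h"
  assumes T: "T \<in> bounded_ops" and S: "\<And>x y. T x \<bullet> y = x \<bullet> S y"
  shows "S \<in> bounded_ops"
  unfolding bounded_ops_def mem_Collect_eq
proof (intro allI, rule eq_if_inner_eq)
  fix c x z
  have "z \<bullet> S (c *\<^sub>C x) = (cnj c *\<^sub>C T z) \<bullet> x"
    by (simp add: inner_scaleC_left flip: S)
  also have "\<dots> = z \<bullet> (c *\<^sub>C S x)"
    by (simp add: S inner_scaleC_left flip: bounded_opsD[OF T])
  finally show "z \<bullet> S (c *\<^sub>C x) = z \<bullet> (c *\<^sub>C S x)" .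
qed

lemma op_adj_eqI:
  fixes S T :: "'h::chilbert_space \<Rightarrow>\<^sub>L 'h"
  assumes T: "T \<in> bounded_ops" and S: "\<And>x y. T x \<bullet> y = x \<bullet> S y"
  shows "op_adj T = S"
  unfolding op_adj_def
proof (rule the_equality)
  have S_mem: "S \<in> bounded_ops"
    using adjoint_in_bounded_ops[OF T S] by blast
  then show "S \<in> bounded_ops \<and> (\<forall>x y. cinner (T x) y = cinner x (S y))"
    using S by (simp add: cinner_eq_inner bounded_opsD[OF S_mem, symmetric])
  fix S' assume S': "S' \<in> bounded_ops \<and> (\<forall>x y. cinner (T x) y = cinner x (S' y))"
  have "x \<bullet> S' y = x \<bullet> S y" for x y
    using S' S[of x y] by (simp add: inner_eq_Re_cinner)
  then show "S' = S"
    by (intro blinfun_eqI, rule eq_if_inner_eq)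
qed

lemma
  fixes T :: "'h::chilbert_space \<Rightarrow>\<^sub>L 'h"
  assumes T: "T \<in> bounded_ops"
  shows op_adj_in_bounded_ops: "op_adj T \<in> bounded_ops"
    and inner_op_adj_right: "x \<bullet> op_adj T y = T x \<bullet> y"
    and inner_op_adj_left: "op_adj T x \<bullet> y = x \<bullet> T y"
proof -
  obtain S :: "'h \<Rightarrow>\<^sub>L 'h" where S: "\<And>x y. T x \<bullet> y = x \<bullet> S y"
    using real_adjoint_exists by blast
  have eq: "op_adj T = S"
    using op_adj_eqI[OF T] S by blast
  show "op_adj T \<in> bounded_ops"
    using adjoint_in_bounded_ops[OF T S] eq by simp
  show "x \<bullet> op_adj T y = T x \<bullet> y" "op_adj T x \<bullet> y = x \<bullet> T y"
    using S eq by (auto simp: inner_commute)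
qed

lemma bounded_ops_compose: "S \<in> bounded_ops \<Longrightarrow> T \<in> bounded_ops \<Longrightarrow> S o\<^sub>L T \<in> bounded_ops"
  by (simp add: bounded_ops_def)

lemma scaleC_zero_right: "c *\<^sub>C (0::'a::complex_inner) = 0"
  by (metis norm_eq_zero norm_scaleC mult_zero_right)

lemma scaleC_uminus_right: "c *\<^sub>C (- x) = - (c *\<^sub>C (x::'a::complex_inner))"
  using scaleC_add_right[of c x "- x"] by (simp add: scaleC_zero_right eq_neg_iff_add_eq_0 add.commute)

lemma scaleC_zero_left: "0 *\<^sub>C (x::'a::complex_inner) = 0"
  by (metis of_real_0 scaleR_scaleC scaleR_zero_left)

lemma scaleC_uminus_left: "(- c) *\<^sub>C x = - (c *\<^sub>C (x::'a::complex_inner))"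
  using scaleC_add_left[of c "- c" x] by (simp add: scaleC_zero_left eq_neg_iff_add_eq_0 add.commute)

lemma bounded_ops_add: "S \<in> bounded_ops \<Longrightarrow> T \<in> bounded_ops \<Longrightarrow> S + T \<in> bounded_ops"
  by (simp add: bounded_ops_def blinfun.bilinear_simps scaleC_add_right)

lemma bounded_ops_uminus: "T \<in> bounded_ops \<Longrightarrow> - T \<in> bounded_ops"
  by (simp add: bounded_ops_def blinfun.bilinear_simps scaleC_uminus_right)

lemma bounded_ops_diff: "S \<in> bounded_ops \<Longrightarrow> T \<in> bounded_ops \<Longrightarrow> S - T \<in> bounded_ops"
  using bounded_ops_add[of S "- T"] bounded_ops_uminus[of T] by simp

lemma scaleC_scaleR_commute: "c *\<^sub>C (r *\<^sub>R x) = r *\<^sub>R (c *\<^sub>C (x::'a::complex_inner))"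
  by (simp add: scaleR_scaleC scaleC_scaleC mult.commute)

lemma bounded_ops_scaleR: "T \<in> bounded_ops \<Longrightarrow> r *\<^sub>R T \<in> bounded_ops"
  by (simp add: bounded_ops_def blinfun.bilinear_simps scaleC_scaleR_commute)

lemma bounded_ops_id: "id_blinfun \<in> bounded_ops"
  by (simp add: bounded_ops_def)

definition op_selfadjoint :: "('a::real_inner \<Rightarrow>\<^sub>L 'a) \<Rightarrow> bool"
  where "op_selfadjoint T \<longleftrightarrow> (\<forall>x y. T x \<bullet> y = x \<bullet> T y)"

lemma op_selfadjointD: "op_selfadjoint T \<Longrightarrow> T x \<bullet> y = x \<bullet> T y"
  by (simp add: op_selfadjoint_def)

text \<open>
  The real part of \<open>\<langle>T x, \<i> x\<rangle>\<close> is the imaginary part of \<open>\<langle>T x, x\<rangle>\<close>, so it vanishes for all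
  \<open>x\<close>; polarizing it gives symmetry.
\<close>

lemma selfadjoint_if_cinner_real:
  fixes T :: "'h::chilbert_space \<Rightarrow>\<^sub>L 'h"
  assumes T: "T \<in> bounded_ops" and real: "\<And>x. cinner (T x) x \<in> \<real>"
  shows "op_selfadjoint T"
  unfolding op_selfadjoint_def
proof (intro allI)
  fix x y :: 'h
  have zero: "(T x) \<bullet> (\<i> *\<^sub>C x) = 0" for x
    using real[of x] by (simp add: complex_is_Real_iff cinner_eq_inner)
  \<comment> \<open>The form that vanishes on the diagonal is evaluated at \<open>x + w\<close>.\<close>
  define w where "w = (- \<i>) *\<^sub>C y"
  have iw: "\<i> *\<^sub>C w = y"
    by (simp add: w_def scaleC_scaleC scaleC_one)
  have "(T x) \<bullet> (\<i> *\<^sub>C w) + (T w) \<bullet> (\<i> *\<^sub>C x) = 0"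
    using zero[of "x + w"] zero[of x] zero[of w]
    by (simp add: blinfun.bilinear_simps scaleC_add_right inner_simps)
  moreover have "(T w) \<bullet> (\<i> *\<^sub>C x) = - (T y \<bullet> x)"
  proof -
    have "T w = (- \<i>) *\<^sub>C T y"
      by (simp add: w_def bounded_opsD[OF T])
    then have "T w \<bullet> (\<i> *\<^sub>C x) = T y \<bullet> ((\<i> * \<i>) *\<^sub>C x)"
      by (simp only: inner_scaleC_left scaleC_scaleC) simp
    also have "(\<i> * \<i>) *\<^sub>C x = - x"
      using scaleR_scaleC[of "-1" x] by simp
    finally show ?thesis by simp
  qed
  ultimately show "T x \<bullet> y = x \<bullet> T y"
    by (simp add: iw inner_commute)
qed

lemma op_positive_iff:
  "op_positive T \<longleftrightarrow> T \<in> bounded_ops \<and> op_selfadjoint T \<and> (\<forall>x. 0 \<le> T x \<bullet> x)"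
proof
  assume pos: "op_positive T"
  then have T: "T \<in> bounded_ops" and nn: "\<And>x. cinner (T x) x \<in> \<real>\<^sub>\<ge>\<^sub>0"
    by (auto simp: op_positive_def)
  have "op_selfadjoint T"
    by (rule selfadjoint_if_cinner_real[OF T]) (use nn nonneg_Reals_subset_Reals in blast)
  moreover have "0 \<le> T x \<bullet> x" for x
    using nn[of x] by (simp add: inner_eq_Re_cinner complex_nonneg_Reals_iff)
  ultimately show "T \<in> bounded_ops \<and> op_selfadjoint T \<and> (\<forall>x. 0 \<le> T x \<bullet> x)"
    using T by blast
next
  assume R: "T \<in> bounded_ops \<and> op_selfadjoint T \<and> (\<forall>x. 0 \<le> T x \<bullet> x)"
  have "cinner (T x) x \<in> \<real>\<^sub>\<ge>\<^sub>0" for x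
  proof -
    have "T x \<bullet> (\<i> *\<^sub>C x) = x \<bullet> (\<i> *\<^sub>C T x)"
      using R by (metis op_selfadjointD bounded_opsD)
    also have "\<dots> = T x \<bullet> ((- \<i>) *\<^sub>C x)"
      by (metis inner_commute inner_scaleC_left complex_cnj_i)
    also have "\<dots> = - (T x \<bullet> (\<i> *\<^sub>C x))"
      by (simp add: scaleC_uminus_left)
    finally show ?thesis
      using R by (simp add: complex_nonneg_Reals_iff cinner_eq_inner)
  qed
  then show "op_positive T" using R by (simp add: op_positive_def)
qed

section \<open>Comparing operators through their norms\<close>

text \<open>
  The positive form is evaluated at \<open>x - (1/c) S x\<close>. In particular \<open>S x\<close> is small as soon as
  \<open>\<langle>S x, x\<rangle>\<close> is.
\<close>

lemma positive_form_estimate: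
  fixes S :: "'a::real_inner \<Rightarrow>\<^sub>L 'a"
  assumes sa: "op_selfadjoint S" and pos: "\<And>x. 0 \<le> S x \<bullet> x"
    and c: "norm S \<le> c" "0 < c"
  shows "(norm (S x))\<^sup>2 \<le> c * (S x \<bullet> x)"
proof -
  define y where "y = S x"
  have "0 \<le> S (x - (1/c) *\<^sub>R y) \<bullet> (x - (1/c) *\<^sub>R y)"
    by (rule pos)
  also have "\<dots> = S x \<bullet> x - 2 / c * (y \<bullet> y) + (S y \<bullet> y) / c\<^sup>2"
    using op_selfadjointD[OF sa, of y x]
    by (simp add: y_def blinfun.bilinear_simps inner_simps inner_commute power2_eq_square
        algebra_simps)
  also have "S y \<bullet> y \<le> c * (y \<bullet> y)"
  proof -
    have "S y \<bullet> y \<le> norm (S y) * norm y"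
      by (rule norm_cauchy_schwarz)
    also have "\<dots> \<le> (c * norm y) * norm y"
      by (intro mult_right_mono order_trans[OF norm_blinfun] c) auto
    finally show ?thesis
      by (simp add: power2_eq_square flip: power2_norm_eq_inner)
  qed
  finally have "0 \<le> S x \<bullet> x - 2 / c * (y \<bullet> y) + (c * (y \<bullet> y)) / c\<^sup>2"
    using c by (simp add: divide_right_mono)
  then have "0 \<le> S x \<bullet> x - (y \<bullet> y) / c"
    using c by (simp add: power2_eq_square)
  then show ?thesis
    using c by (simp add: y_def power2_norm_eq_inner field_simps)
qed

lemma abs_inner_blinfun_le: "\<bar>S x \<bullet> x\<bar> \<le> norm S * (norm x)\<^sup>2"
  for S :: "'a::real_inner \<Rightarrow>\<^sub>L 'a"
proof -
  have "\<bar>S x \<bullet> x\<bar> \<le> norm (S x) * norm x"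
    by (rule Cauchy_Schwarz_ineq2)
  also have "\<dots> \<le> (norm S * norm x) * norm x"
    by (intro mult_right_mono norm_blinfun) auto
  finally show ?thesis
    by (simp add: power2_eq_square)
qed

text \<open>
  Take \<open>l\<close> to be the supremum of \<open>\<langle>D u, u\<rangle>\<close> over unit vectors. Then \<open>l - D\<close> is positive, and
  for a sequence of unit vectors that approaches the supremum \<open>positive_form_estimate\<close> turns the
  smallness of its form into the smallness of \<open>(l - D) u\<close>.
\<close>

lemma approximate_top_eigenvector:
  fixes D :: "'a::real_inner \<Rightarrow>\<^sub>L 'a"
  assumes sa: "op_selfadjoint D" and x: "0 < D x \<bullet> x"
  obtains l and u :: "nat \<Rightarrow> 'a" where "0 < l" and "\<And>n. norm (u n) = 1"
    and "(\<lambda>n. D (u n) - l *\<^sub>R u n) \<longlonglongrightarrow> 0"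
proof -
  define V where "V = (\<lambda>u. D u \<bullet> u) ` sphere 0 1"
  define l where "l = Sup V"
  have le: "D u \<bullet> u \<le> norm D" if "norm u = 1" for u
    using abs_inner_blinfun_le[of D u] that by simp
  then have bdd: "bdd_above V"
    by (auto simp: V_def intro!: bdd_aboveI[of _ "norm D"])
  have upper: "D u \<bullet> u \<le> l" if "norm u = 1" for u
    unfolding l_def by (rule cSup_upper[OF _ bdd]) (use that in \<open>auto simp: V_def\<close>)
  define u0 where "u0 = (1 / norm x) *\<^sub>R x"
  have nx: "x \<noteq> 0" using x by auto
  then have u0: "norm u0 = 1" by (simp add: u0_def)
  have "0 < D u0 \<bullet> u0"
    using x nx by (simp add: u0_def blinfun.bilinear_simps)
  then have l: "0 < l"
    using upper[OF u0] by simp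
  have "\<exists>u. norm u = 1 \<and> l - 1 / real (Suc n) < D u \<bullet> u" for n
  proof -
    have "V \<noteq> {}"
      using u0 by (auto simp: V_def)
    then obtain v where "v \<in> V" "l - 1 / real (Suc n) < v"
      using less_cSupD[of V "l - 1 / real (Suc n)"] by (auto simp: l_def)
    then show ?thesis
      by (auto simp: V_def)
  qed
  then obtain u :: "nat \<Rightarrow> 'a" where u: "\<And>n. norm (u n) = 1" "\<And>n. l - 1 / real (Suc n) < D (u n) \<bullet> u n"
    by metis
  define S where "S = l *\<^sub>R id_blinfun - D"
  have S_apply: "S x = l *\<^sub>R x - D x" for x
    by (simp add: S_def blinfun.bilinear_simps)
  have S_sa: "op_selfadjoint S"
    using sa by (simp add: op_selfadjoint_def S_apply inner_simps)
  have S_pos: "0 \<le> S y \<bullet> y" for y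
  proof (cases "y = 0")
    case False
    have "D ((1 / norm y) *\<^sub>R y) \<bullet> ((1 / norm y) *\<^sub>R y) \<le> l"
      by (rule upper) (use False in simp)
    then have "(D y \<bullet> y) / (norm y)\<^sup>2 \<le> l"
      by (simp add: blinfun.bilinear_simps power2_eq_square)
    then show ?thesis
      using False by (simp add: S_apply inner_simps power2_norm_eq_inner[symmetric] field_simps)
  qed simp
  have bound: "(norm (D (u n) - l *\<^sub>R u n))\<^sup>2 \<le> (norm S + 1) * (1 / real (Suc n))" for n
  proof -
    have "(norm (D (u n) - l *\<^sub>R u n))\<^sup>2 = (norm (S (u n)))\<^sup>2"
      by (simp add: S_apply norm_minus_commute)
    also have "\<dots> \<le> (norm S + 1) * (S (u n) \<bullet> u n)"
      by (rule positive_form_estimate[OF S_sa S_pos]) (auto intro: add_nonneg_pos)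
    also have "S (u n) \<bullet> u n \<le> 1 / real (Suc n)"
      using u(2)[of n] u(1)[of n]
      by (simp add: S_apply inner_simps power2_norm_eq_inner[symmetric])
    finally show ?thesis
      by (simp add: mult_left_mono)
  qed
  have "(\<lambda>n. (norm S + 1) * (1 / real (Suc n))) \<longlonglongrightarrow> (norm S + 1) * 0"
    by (intro tendsto_mult tendsto_const LIMSEQ_Suc[OF lim_1_over_n])
  then have lim: "(\<lambda>n. (norm S + 1) * (1 / real (Suc n))) \<longlonglongrightarrow> 0"
    by simp
  have "(\<lambda>n. (norm (D (u n) - l *\<^sub>R u n))\<^sup>2) \<longlonglongrightarrow> 0"
  proof (rule Lim_null_comparison[OF _ lim])
    show "\<forall>\<^sub>F n in sequentially. norm ((norm (D (u n) - l *\<^sub>R u n))\<^sup>2)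
        \<le> (norm S + 1) * (1 / real (Suc n))"
      using bound by simp
  qed
  then have "(\<lambda>n. sqrt ((norm (D (u n) - l *\<^sub>R u n))\<^sup>2)) \<longlonglongrightarrow> sqrt 0"
    by (rule tendsto_real_sqrt)
  then have "(\<lambda>n. norm (D (u n) - l *\<^sub>R u n)) \<longlonglongrightarrow> 0"
    by simp
  then have "(\<lambda>n. D (u n) - l *\<^sub>R u n) \<longlonglongrightarrow> 0"
    by (rule tendsto_norm_zero_cancel)
  with l u(1) show thesis using that by blast
qed

text \<open>
  For operators this says that \<open>H\<^sup>2 \<le> R\<^sup>2\<close> implies \<open>H \<le> R\<close>; for positive \<open>H\<close> it is the monotonicity
  of the square root. If \<open>D = H - R\<close> took a positive value, it would have an approximate eigenvector
  for some \<open>l > 0\<close>, along which \<open>\<parallel>H u\<parallel>\<^sup>2 - \<parallel>R u\<parallel>\<^sup>2\<close> approaches at least \<open>l\<^sup>2\<close>.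
\<close>

lemma inner_le_if_norm_le:
  fixes H R :: "'a::real_inner \<Rightarrow>\<^sub>L 'a"
  assumes H: "op_selfadjoint H" and R: "op_selfadjoint R"
    and pos: "\<And>x. 0 \<le> R x \<bullet> x" and le: "\<And>x. norm (H x) \<le> norm (R x)"
  shows "H x \<bullet> x \<le> R x \<bullet> x"
proof (rule ccontr)
  assume neg: "\<not> ?thesis"
  define D where "D = H - R"
  have D_apply: "D x = H x - R x" for x
    by (simp add: D_def blinfun.bilinear_simps)
  have D_sa: "op_selfadjoint D"
    using H R by (simp add: op_selfadjoint_def D_apply inner_simps)
  have "0 < D x \<bullet> x"
    using neg by (simp add: D_apply inner_simps)
  then obtain l and u :: "nat \<Rightarrow> 'a" where l: "0 < l" and u: "\<And>n. norm (u n) = 1"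
    and lim: "(\<lambda>n. D (u n) - l *\<^sub>R u n) \<longlonglongrightarrow> 0"
    using approximate_top_eigenvector[OF D_sa] by blast
  define e where "e n = D (u n) - l *\<^sub>R u n" for n
  have e: "e \<longlonglongrightarrow> 0"
    using lim by (simp add: e_def[abs_def])
  \<comment> \<open>Since \<open>H = R + D\<close>, the hypothesis reads \<open>2 \<langle>D u, R u\<rangle> + \<parallel>D u\<parallel>\<^sup>2 \<le> 0\<close>; on an
    approximate eigenvector the left-hand side is at least \<open>l\<^sup>2\<close> up to an error term.\<close>
  have ineq: "l\<^sup>2 \<le> - 2 * (e n \<bullet> R (u n)) - 2 * l * (e n \<bullet> u n)" for n
  proof -
    have "(norm (R (u n) + D (u n)))\<^sup>2 \<le> (norm (R (u n)))\<^sup>2"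
      using le[of "u n"] by (simp add: D_apply power_mono)
    then have "2 * (D (u n) \<bullet> R (u n)) + D (u n) \<bullet> D (u n) \<le> 0"
      by (simp add: power2_norm_eq_inner inner_simps inner_commute)
    moreover have "D (u n) = e n + l *\<^sub>R u n"
      by (simp add: e_def)
    moreover have "u n \<bullet> u n = 1"
      using u[of n] by (simp flip: power2_norm_eq_inner)
    ultimately have "2 * (e n \<bullet> R (u n)) + 2 * l * (R (u n) \<bullet> u n)
        + e n \<bullet> e n + 2 * l * (e n \<bullet> u n) + l\<^sup>2 \<le> 0"
      by (simp add: inner_simps inner_commute power2_eq_square algebra_simps)
    moreover have "0 \<le> 2 * l * (R (u n) \<bullet> u n)"
      using l pos by simp
    ultimately show ?thesis
      using inner_ge_zero[of "e n"] by linarith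
  qed
  have zero: "(\<lambda>n. e n \<bullet> w n) \<longlonglongrightarrow> 0" if w: "\<And>n. norm (w n) \<le> K" for w K
  proof (rule Lim_null_comparison)
    have "norm (e n \<bullet> w n) \<le> norm (e n) * K" for n
      using Cauchy_Schwarz_ineq2[of "e n" "w n"] mult_left_mono[OF w[of n] norm_ge_zero[of "e n"]]
      by simp
    then show "\<forall>\<^sub>F n in sequentially. norm (e n \<bullet> w n) \<le> norm (e n) * K"
      by simp
    show "(\<lambda>n. norm (e n) * K) \<longlonglongrightarrow> 0"
      using tendsto_mult[OF tendsto_norm[OF e] tendsto_const[of K]] by simp
  qed
  have "(\<lambda>n. e n \<bullet> R (u n)) \<longlonglongrightarrow> 0"
    by (rule zero[where K = "norm R"]) (metis norm_blinfun u mult.right_neutral)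
  moreover have "(\<lambda>n. e n \<bullet> u n) \<longlonglongrightarrow> 0"
    by (rule zero[where K = 1]) (simp add: u)
  ultimately have "(\<lambda>n. - 2 * (e n \<bullet> R (u n)) - 2 * l * (e n \<bullet> u n)) \<longlonglongrightarrow> - 2 * 0 - 2 * l * 0"
    by (intro tendsto_diff tendsto_mult tendsto_const)
  then have "l\<^sup>2 \<le> - 2 * 0 - 2 * l * 0"
    by (rule LIMSEQ_le_const) (use ineq in blast)
  then show False
    using l by simp
qed

lemma selfadjoint_zero_if_form_zero:
  fixes D :: "'a::real_inner \<Rightarrow>\<^sub>L 'a"
  assumes sa: "op_selfadjoint D" and form: "\<And>x. D x \<bullet> x = 0"
  shows "D = 0"
proof (rule blinfun_eqI)
  fix x
  have "(norm (D x))\<^sup>2 \<le> (norm D + 1) * (D x \<bullet> x)"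
    by (rule positive_form_estimate[OF sa]) (auto simp: form intro: add_nonneg_pos)
  then show "D x = blinfun_apply 0 x"
    by (simp add: form)
qed

lemma positive_square_root_unique:
  assumes S: "op_positive S" and R: "op_positive R" and eq: "S o\<^sub>L S = R o\<^sub>L R"
  shows "S = R"
proof -
  have S': "op_selfadjoint S" "\<And>x. 0 \<le> S x \<bullet> x" and R': "op_selfadjoint R" "\<And>x. 0 \<le> R x \<bullet> x"
    using S R by (auto simp: op_positive_iff)
  have norm_eq: "norm (S x) = norm (R x)" for x
  proof -
    have "S x \<bullet> S x = (S o\<^sub>L S) x \<bullet> x" "R x \<bullet> R x = (R o\<^sub>L R) x \<bullet> x"
      using op_selfadjointD[OF S'(1), of "S x" x] op_selfadjointD[OF R'(1), of "R x" x] by auto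
    then show ?thesis
      by (simp add: eq norm_eq_sqrt_inner)
  qed
  have "S x \<bullet> x = R x \<bullet> x" for x
    using inner_le_if_norm_le[OF S'(1) R'] inner_le_if_norm_le[OF R'(1) S'] norm_eq
    by (simp add: order_antisym)
  then have "S - R = 0"
    using S' R' by (intro selfadjoint_zero_if_form_zero)
      (auto simp: op_selfadjoint_def blinfun.bilinear_simps inner_simps)
  then show ?thesis by simp
qed

section \<open>Power series of operators\<close>

text \<open>
  The product of the partial sums is a sum over a square of indices, the partial sums of the Cauchy
  product are sums over a triangle. The norm of the difference is at most a constant times the
  same difference for the two series of norms, which tends to zero because the Cauchy product
  of absolutely convergent real series converges to the product.
\<close>

lemma (in bounded_bilinear) Cauchy_product_sums:
  assumes a: "summable (\<lambda>k. norm (a k))" and b: "summable (\<lambda>k. norm (b k))"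
    and A: "a sums x" and B: "b sums y"
  shows "(\<lambda>k. \<Sum>i\<le>k. prod (a i) (b (k - i))) sums prod x y"
proof -
  obtain K where K: "\<And>u v. norm (prod u v) \<le> norm u * norm v * K"
    using bounded by blast
  define sq where "sq n = {..<n} \<times> {..<n}" for n :: nat
  define tri where "tri n = {(i, j). i + j < n}" for n :: nat
  have sub: "tri n \<subseteq> sq n" and fin: "finite (sq n)" for n
    by (auto simp: sq_def tri_def)
  have tri_sum: "(\<Sum>k<n. \<Sum>i\<le>k. f i (k - i)) = (\<Sum>(i, j)\<in>tri n. f i j)"
    for f :: "nat \<Rightarrow> nat \<Rightarrow> 'z::comm_monoid_add" and n
    unfolding tri_def by (rule sum.triangle_reindex[symmetric])
  have sq_norm: "(\<Sum>(i, j)\<in>sq n. norm (a i) * norm (b j))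
      = (\<Sum>i<n. norm (a i)) * (\<Sum>j<n. norm (b j))" for n
    by (simp add: sq_def sum_product sum.cartesian_product)
  have sq_prod: "(\<Sum>(i, j)\<in>sq n. prod (a i) (b j)) = prod (\<Sum>i<n. a i) (\<Sum>j<n. b j)" for n
    unfolding sq_def sum.cartesian_product[symmetric]
    by (simp only: sum_left) (simp only: sum_right)
  have lim_sq: "(\<lambda>n. \<Sum>(i, j)\<in>sq n. prod (a i) (b j)) \<longlonglongrightarrow> prod x y"
    unfolding sq_prod using A B by (intro tendsto) (simp_all add: sums_def)
  define E where "E n = (\<Sum>(i, j)\<in>sq n. norm (a i) * norm (b j))
      - (\<Sum>(i, j)\<in>tri n. norm (a i) * norm (b j))" for n
  have "(\<lambda>n. \<Sum>(i, j)\<in>sq n. norm (a i) * norm (b j))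
      \<longlonglongrightarrow> (\<Sum>i. norm (a i)) * (\<Sum>j. norm (b j))"
    unfolding sq_norm by (intro tendsto_mult summable_LIMSEQ a b)
  moreover have "(\<lambda>n. \<Sum>(i, j)\<in>tri n. norm (a i) * norm (b j))
      \<longlonglongrightarrow> (\<Sum>i. norm (a i)) * (\<Sum>j. norm (b j))"
    using Series.Cauchy_product_sums[of "\<lambda>i. norm (a i)" "\<lambda>i. norm (b i)"] a b
    by (simp add: sums_def tri_sum[of "\<lambda>i j. norm (a i) * norm (b j)"])
  ultimately have "E \<longlonglongrightarrow> 0"
    unfolding E_def[abs_def] using tendsto_diff by fastforce
  then have E: "(\<lambda>n. E n * K) \<longlonglongrightarrow> 0"
    by (simp add: tendsto_mult_left_zero)
  have "(\<lambda>n. (\<Sum>(i, j)\<in>sq n. prod (a i) (b j)) - (\<Sum>(i, j)\<in>tri n. prod (a i) (b j))) \<longlonglongrightarrow> 0"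
  proof (rule Lim_null_comparison[OF _ E])
    have "norm ((\<Sum>(i, j)\<in>sq n. prod (a i) (b j)) - (\<Sum>(i, j)\<in>tri n. prod (a i) (b j)))
        \<le> E n * K" for n
    proof -
      have "(\<Sum>(i, j)\<in>sq n. prod (a i) (b j)) - (\<Sum>(i, j)\<in>tri n. prod (a i) (b j))
          = (\<Sum>(i, j)\<in>sq n - tri n. prod (a i) (b j))"
        by (rule sum_diff[symmetric]) (use sub fin in auto)
      also have "norm \<dots> \<le> (\<Sum>(i, j)\<in>sq n - tri n. norm (a i) * norm (b j) * K)"
        by (rule sum_norm_le) (auto simp: K)
      also have "\<dots> = (\<Sum>(i, j)\<in>sq n - tri n. norm (a i) * norm (b j)) * K"
        by (simp add: sum_distrib_right split_beta)
      also have "(\<Sum>(i, j)\<in>sq n - tri n. norm (a i) * norm (b j)) = E n"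
        unfolding E_def by (rule sum_diff) (use sub fin in auto)
      finally show ?thesis .
    qed
    then show "\<forall>\<^sub>F n in sequentially. norm ((\<Sum>(i, j)\<in>sq n. prod (a i) (b j))
        - (\<Sum>(i, j)\<in>tri n. prod (a i) (b j))) \<le> E n * K"
      by simp
  qed
  from tendsto_diff[OF lim_sq this] show ?thesis
    by (simp add: sums_def tri_sum[of "\<lambda>i j. prod (a i) (b j)"])
qed

subclass (in chilbert_space) banach ..

primrec op_pow :: "('a::real_normed_vector \<Rightarrow>\<^sub>L 'a) \<Rightarrow> nat \<Rightarrow> ('a \<Rightarrow>\<^sub>L 'a)" where
  "op_pow T 0 = id_blinfun"
| "op_pow T (Suc n) = T o\<^sub>L op_pow T n"

lemma blinfun_compose_assoc: "(R o\<^sub>L S) o\<^sub>L T = R o\<^sub>L (S o\<^sub>L T)"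
  by (rule blinfun_eqI) simp

lemma blinfun_compose_id [simp]: "T o\<^sub>L id_blinfun = T" "id_blinfun o\<^sub>L T = T"
  by (rule blinfun_eqI, simp)+

lemma compose_commute_apply: "S o\<^sub>L T = T o\<^sub>L S \<Longrightarrow> S (T x) = T (S x)"
  by (metis blinfun_apply_blinfun_compose)

lemma op_pow_add: "op_pow T (m + n) = op_pow T m o\<^sub>L op_pow T n"
  by (induction m) (simp_all add: blinfun_compose_assoc)

lemma op_pow_commute: "S o\<^sub>L T = T o\<^sub>L S \<Longrightarrow> S o\<^sub>L op_pow T n = op_pow T n o\<^sub>L S"
proof (induction n)
  case (Suc n)
  have "S o\<^sub>L (T o\<^sub>L op_pow T n) = T o\<^sub>L (S o\<^sub>L op_pow T n)"
    by (simp add: Suc.prems flip: blinfun_compose_assoc)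
  then show ?case
    by (simp add: Suc blinfun_compose_assoc)
qed simp

lemma norm_op_pow_le: "norm (op_pow T n) \<le> norm T ^ n"
proof (induction n)
  case 0
  show ?case by (simp add: norm_blinfun_id_le)
next
  case (Suc n)
  have "norm (op_pow T (Suc n)) \<le> norm T * norm (op_pow T n)"
    by (simp add: norm_blinfun_compose)
  also have "\<dots> \<le> norm T * norm T ^ n"
    by (intro mult_left_mono Suc.IH) simp
  finally show ?case by simp
qed

lemma op_pow_adjoint:
  fixes S T :: "'a::real_inner \<Rightarrow>\<^sub>L 'a"
  assumes adj: "\<And>x y. S x \<bullet> y = x \<bullet> T y"
  shows "op_pow S n x \<bullet> y = x \<bullet> op_pow T n y"
proof (induction n arbitrary: y)
  case (Suc n)
  have "op_pow T n (T y) = T (op_pow T n y)"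
    by (rule compose_commute_apply[OF op_pow_commute[of T T n, OF refl], symmetric])
  then show ?case
    by (simp add: adj Suc)
qed simp

definition op_series :: "(nat \<Rightarrow> real) \<Rightarrow> ('a::banach \<Rightarrow>\<^sub>L 'a) \<Rightarrow> ('a \<Rightarrow>\<^sub>L 'a)"
  where "op_series a T = (\<Sum>n. a n *\<^sub>R op_pow T n)"

definition op_series_converges :: "(nat \<Rightarrow> real) \<Rightarrow> ('a::banach \<Rightarrow>\<^sub>L 'a) \<Rightarrow> bool"
  where "op_series_converges a T \<longleftrightarrow> summable (\<lambda>n. \<bar>a n\<bar> * norm T ^ n)"

lemma op_series_summable_norm:
  assumes "op_series_converges a T"
  shows "summable (\<lambda>n. norm (a n *\<^sub>R op_pow T n))"
  by (rule summable_comparison_test'[OF assms[unfolded op_series_converges_def]])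
    (simp add: norm_op_pow_le mult_left_mono)

lemma op_series_sums:
  assumes "op_series_converges a T"
  shows "(\<lambda>n. a n *\<^sub>R op_pow T n) sums op_series a T"
  unfolding op_series_def
  by (rule summable_sums[OF summable_norm_cancel[OF op_series_summable_norm[OF assms]]])

lemma op_series_sums_apply:
  assumes "op_series_converges a T"
  shows "(\<lambda>n. a n *\<^sub>R op_pow T n x) sums op_series a T x"
  using bounded_linear.sums[OF blinfun.bounded_linear_left op_series_sums[OF assms], of x]
  by (simp add: blinfun.bilinear_simps)

lemma op_series_commute:
  assumes conv: "op_series_converges a T" and comm: "S o\<^sub>L T = T o\<^sub>L S"
  shows "S o\<^sub>L op_series a T = op_series a T o\<^sub>L S"
proof (rule sums_unique2)
  note bb = bounded_bilinear_blinfun_compose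
  show "(\<lambda>n. S o\<^sub>L (a n *\<^sub>R op_pow T n)) sums (S o\<^sub>L op_series a T)"
    by (rule bounded_linear.sums[OF bounded_bilinear.bounded_linear_right[OF bb] op_series_sums[OF conv]])
  have "S o\<^sub>L (a n *\<^sub>R op_pow T n) = (a n *\<^sub>R op_pow T n) o\<^sub>L S" for n
    using op_pow_commute[OF comm, of n]
    by (simp add: bounded_bilinear.scaleR_left[OF bb] bounded_bilinear.scaleR_right[OF bb])
  then show "(\<lambda>n. S o\<^sub>L (a n *\<^sub>R op_pow T n)) sums (op_series a T o\<^sub>L S)"
    using bounded_linear.sums[OF bounded_bilinear.bounded_linear_left[OF bb] op_series_sums[OF conv]]
    by simp
qed

lemma op_series_adjoint:
  fixes S T :: "'a::{real_inner, banach} \<Rightarrow>\<^sub>L 'a"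
  assumes S: "op_series_converges a S" and T: "op_series_converges a T"
    and adj: "\<And>x y. S x \<bullet> y = x \<bullet> T y"
  shows "op_series a S x \<bullet> y = x \<bullet> op_series a T y"
proof -
  have "(\<lambda>n. (a n *\<^sub>R op_pow S n x) \<bullet> y) sums (op_series a S x \<bullet> y)"
    by (rule bounded_linear.sums[OF bounded_linear_inner_left op_series_sums_apply[OF S]])
  moreover have "(\<lambda>n. x \<bullet> (a n *\<^sub>R op_pow T n y)) sums (x \<bullet> op_series a T y)"
    by (rule bounded_linear.sums[OF bounded_linear_inner_right op_series_sums_apply[OF T]])
  ultimately show ?thesis
    by (simp add: op_pow_adjoint[of S T, OF adj] sums_unique2)
qed

lemma op_series_mult:
  assumes a: "op_series_converges a S" and b: "op_series_converges b T"
  shows "(\<lambda>k. \<Sum>i\<le>k. (a i *\<^sub>R op_pow S i) o\<^sub>L (b (k - i) *\<^sub>R op_pow T (k - i)))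
    sums (op_series a S o\<^sub>L op_series b T)"
  by (intro bounded_bilinear.Cauchy_product_sums[OF bounded_bilinear_blinfun_compose]
      op_series_summable_norm op_series_sums a b)

definition scaleC_op :: "complex \<Rightarrow> ('a::complex_inner \<Rightarrow>\<^sub>L 'a)"
  where "scaleC_op c = Blinfun (\<lambda>x. c *\<^sub>C x)"

lemma scaleC_op_apply [simp]: "scaleC_op c x = c *\<^sub>C x"
proof -
  have "bounded_linear (\<lambda>x::'a. c *\<^sub>C x)"
    by (rule bounded_linear_intro[where K = "cmod c"])
      (simp_all add: scaleC_add_right scaleC_scaleR_commute norm_scaleC mult.commute)
  then show ?thesis
    by (simp add: scaleC_op_def bounded_linear_Blinfun_apply)
qed

text \<open>
  Complex linearity as a commutation property, so that whatever is preserved by passing to the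
  commutant is preserved here too.
\<close>

lemma bounded_ops_iff: "T \<in> bounded_ops \<longleftrightarrow> (\<forall>c. scaleC_op c o\<^sub>L T = T o\<^sub>L scaleC_op c)"
proof
  assume "T \<in> bounded_ops"
  then show "\<forall>c. scaleC_op c o\<^sub>L T = T o\<^sub>L scaleC_op c"
    by (auto intro!: blinfun_eqI simp: bounded_opsD)
next
  assume *: "\<forall>c. scaleC_op c o\<^sub>L T = T o\<^sub>L scaleC_op c"
  have "T (c *\<^sub>C x) = c *\<^sub>C T x" for c x
    using compose_commute_apply[OF *[rule_format, of c], of x] by simp
  then show "T \<in> bounded_ops" by (simp add: bounded_ops_def)
qed

lemma op_series_in_bounded_ops:
  "op_series_converges a T \<Longrightarrow> T \<in> bounded_ops \<Longrightarrow> op_series a T \<in> bounded_ops"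
  unfolding bounded_ops_iff using op_series_commute by blast

section \<open>Positive square roots and the modulus\<close>

text \<open>
  The Taylor coefficients of \<open>sqrt (1 - t)\<close> at \<open>0\<close>.
\<close>

definition sqrt_coeff :: "nat \<Rightarrow> real"
  where "sqrt_coeff n = (-1) ^ n * (1/2 gchoose n)"

lemma sqrt_coeff_0: "sqrt_coeff 0 = 1"
  by (simp add: sqrt_coeff_def)

lemma sqrt_coeff_pochhammer: "sqrt_coeff n = pochhammer (- 1/2) n / fact n"
  by (simp add: sqrt_coeff_def gbinomial_pochhammer flip: power_mult_distrib mult.assoc)

lemma sqrt_coeff_nonpos: "0 < n \<Longrightarrow> sqrt_coeff n \<le> 0"
proof -
  assume "0 < n"
  then obtain m where m: "n = Suc m" using gr0_conv_Suc by blast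
  have "0 < pochhammer (1/2 :: real) m"
    by (rule pochhammer_pos) simp
  then show ?thesis
    by (simp add: sqrt_coeff_pochhammer m pochhammer_rec divide_le_0_iff mult_le_0_iff)
qed

text \<open>
  Passing to partial sums divides the series by \<open>1 - t\<close>, so these are the Taylor coefficients
  of \<open>(1 - t) powr (- 1/2)\<close>, which are nonnegative.
\<close>

lemma sum_sqrt_coeff_nonneg: "0 \<le> sum sqrt_coeff {..m}"
proof -
  have "sum sqrt_coeff {..m} = (-1) ^ m * ((1/2 - 1 :: real) gchoose m)"
    unfolding gbinomial_sum_lower_neg[symmetric] by (simp add: sqrt_coeff_def mult.commute)
  also have "\<dots> = pochhammer (1/2) m / fact m"
    by (simp add: gbinomial_pochhammer flip: power_mult_distrib mult.assoc)
  also have "0 \<le> \<dots>"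
    by (simp add: pochhammer_nonneg)
  finally show ?thesis .
qed

text \<open>
  Only the coefficient at \<open>0\<close> is positive, so a partial sum of absolute values is \<open>2\<close> minus a
  partial sum of the coefficients themselves. Absolute summability is what makes the series
  converge in norm on the whole closed unit ball.
\<close>

lemma summable_abs_sqrt_coeff: "summable (\<lambda>n. \<bar>sqrt_coeff n\<bar>)"
proof (rule summableI_nonneg_bounded)
  fix n
  have "(\<Sum>i<n. \<bar>sqrt_coeff i\<bar>) \<le> (\<Sum>i\<le>n. \<bar>sqrt_coeff i\<bar>)"
    by (rule sum_mono2) auto
  also have "\<dots> = (\<Sum>i\<le>n. (if i = 0 then 2 else 0) - sqrt_coeff i)"
    by (rule sum.cong) (auto simp: sqrt_coeff_0 sqrt_coeff_nonpos)
  also have "\<dots> \<le> 2"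
    using sum_sqrt_coeff_nonneg[of n] by (simp add: sum_subtractf sum.delta)
  finally show "(\<Sum>i<n. \<bar>sqrt_coeff i\<bar>) \<le> 2" .
qed simp

text \<open>
  The square of the series is \<open>1 - t\<close>, by the Vandermonde identity for exponents \<open>1/2 + 1/2 = 1\<close>.
\<close>

lemma sqrt_coeff_convolution:
  "(\<Sum>i\<le>k. sqrt_coeff i * sqrt_coeff (k - i)) = (if k = 0 then 1 else if k = 1 then -1 else 0)"
proof -
  have "(\<Sum>i\<le>k. sqrt_coeff i * sqrt_coeff (k - i))
      = (\<Sum>i\<le>k. (-1) ^ k * ((1/2 gchoose i) * (1/2 gchoose (k - i))))"
  proof (rule sum.cong)
    fix i assume "i \<in> {..k}"
    then have "(-1 :: real) ^ k = (-1) ^ i * (-1) ^ (k - i)"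
      by (simp flip: power_add)
    then show "sqrt_coeff i * sqrt_coeff (k - i)
        = (-1) ^ k * ((1/2 gchoose i) * (1/2 gchoose (k - i)))"
      by (simp add: sqrt_coeff_def)
  qed simp
  also have "\<dots> = (-1) ^ k * ((1 :: real) gchoose k)"
    using gbinomial_Vandermonde[of "1/2 :: real" "1/2" k]
    by (simp add: atMost_atLeast0 flip: sum_distrib_left)
  also have "(1 :: real) gchoose k = of_nat (1 choose k)"
    by (metis binomial_gbinomial of_nat_1)
  also have "(-1) ^ k * (of_nat (1 choose k) :: real)
      = (if k = 0 then 1 else if k = 1 then -1 else 0)"
    by (auto simp: binomial_eq_0)
  finally show ?thesis .
qed

lemma op_series_sqrt_coeff_square:
  assumes conv: "op_series_converges sqrt_coeff X"
  shows "op_series sqrt_coeff X o\<^sub>L op_series sqrt_coeff X = id_blinfun - X"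
proof -
  note bb = bounded_bilinear_blinfun_compose
  define c :: "nat \<Rightarrow> real" where "c k = (if k = 0 then 1 else if k = 1 then -1 else 0)" for k
  have "(\<Sum>i\<le>k. (sqrt_coeff i *\<^sub>R op_pow X i) o\<^sub>L (sqrt_coeff (k - i) *\<^sub>R op_pow X (k - i)))
      = c k *\<^sub>R op_pow X k" for k
  proof -
    have "(\<Sum>i\<le>k. (sqrt_coeff i *\<^sub>R op_pow X i) o\<^sub>L (sqrt_coeff (k - i) *\<^sub>R op_pow X (k - i)))
        = (\<Sum>i\<le>k. (sqrt_coeff i * sqrt_coeff (k - i)) *\<^sub>R op_pow X k)"
    proof (rule sum.cong)
      fix i assume "i \<in> {..k}"
      then have "op_pow X k = op_pow X i o\<^sub>L op_pow X (k - i)"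
        by (simp flip: op_pow_add)
      then show "(sqrt_coeff i *\<^sub>R op_pow X i) o\<^sub>L (sqrt_coeff (k - i) *\<^sub>R op_pow X (k - i))
          = (sqrt_coeff i * sqrt_coeff (k - i)) *\<^sub>R op_pow X k"
        by (simp add: bounded_bilinear.scaleR_left[OF bb] bounded_bilinear.scaleR_right[OF bb])
    qed simp
    then show ?thesis
      by (simp add: sqrt_coeff_convolution c_def flip: scaleR_left.sum)
  qed
  then have "(\<lambda>k. c k *\<^sub>R op_pow X k) sums (op_series sqrt_coeff X o\<^sub>L op_series sqrt_coeff X)"
    using op_series_mult[OF conv conv] by simp
  moreover have "(\<lambda>k. c k *\<^sub>R op_pow X k) sums (\<Sum>k\<in>{0, 1}. c k *\<^sub>R op_pow X k)"
    by (rule sums_finite) (auto simp: c_def)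
  ultimately show ?thesis
    using sums_unique2 by (fastforce simp: c_def)
qed

lemma norm_le_1_if_between:
  fixes X :: "'a::real_inner \<Rightarrow>\<^sub>L 'a"
  assumes sa: "op_selfadjoint X" and pos: "\<And>x. 0 \<le> X x \<bullet> x" and le: "\<And>x. X x \<bullet> x \<le> x \<bullet> x"
  shows "norm X \<le> 1"
proof (rule ccontr)
  assume "\<not> ?thesis"
  then have X: "1 < norm X" by simp
  have "norm (X x) \<le> sqrt (norm X) * norm x" for x
  proof -
    have "(norm (X x))\<^sup>2 \<le> norm X * (X x \<bullet> x)"
      by (rule positive_form_estimate[OF sa pos]) (use X in auto)
    also have "\<dots> \<le> norm X * (x \<bullet> x)"
      by (rule mult_left_mono[OF le]) simp
    also have "\<dots> = (sqrt (norm X) * norm x)\<^sup>2"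
      by (simp add: power_mult_distrib power2_norm_eq_inner)
    finally show ?thesis
      by (rule power2_le_imp_le) simp
  qed
  then have "norm X \<le> sqrt (norm X)"
    by (intro norm_blinfun_bound) auto
  then have "norm X * norm X \<le> sqrt (norm X) * sqrt (norm X)"
    by (intro mult_mono) auto
  then have "norm X * norm X \<le> norm X * 1"
    by simp
  then show False
    using X by (simp only: mult_le_cancel_left_pos)
qed

text \<open>
  All coefficients but the first are nonpositive and \<open>\<langle>X\<^sup>n x, x\<rangle> \<le> \<langle>x, x\<rangle>\<close>, so each partial sum is
  bounded below by the corresponding partial sum of coefficients times \<open>\<langle>x, x\<rangle>\<close>.
\<close>

lemma op_series_sqrt_coeff_nonneg:
  fixes X :: "'a::{real_inner, banach} \<Rightarrow>\<^sub>L 'a"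
  assumes X: "norm X \<le> 1" and conv: "op_series_converges sqrt_coeff X"
  shows "0 \<le> op_series sqrt_coeff X x \<bullet> x"
proof -
  have le: "op_pow X n x \<bullet> x \<le> x \<bullet> x" for n
  proof -
    have "op_pow X n x \<bullet> x \<le> norm (op_pow X n) * (norm x)\<^sup>2"
      using abs_inner_blinfun_le[of "op_pow X n" x] by simp
    also have "\<dots> \<le> 1 * (norm x)\<^sup>2"
      using order_trans[OF norm_op_pow_le power_le_one[OF norm_ge_zero X]]
      by (intro mult_right_mono) auto
    finally show ?thesis
      by (simp add: power2_norm_eq_inner)
  qed
  have "0 \<le> (\<Sum>n\<le>m. sqrt_coeff n *\<^sub>R op_pow X n x \<bullet> x)" for m
  proof -
    have "0 \<le> sum sqrt_coeff {..m} * (x \<bullet> x)"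
      by (simp add: sum_sqrt_coeff_nonneg)
    also have "\<dots> = (\<Sum>n\<le>m. sqrt_coeff n * (x \<bullet> x))"
      by (rule sum_distrib_right)
    also have "\<dots> \<le> (\<Sum>n\<le>m. sqrt_coeff n *\<^sub>R op_pow X n x \<bullet> x)"
    proof (rule sum_mono)
      fix n
      show "sqrt_coeff n * (x \<bullet> x) \<le> sqrt_coeff n *\<^sub>R op_pow X n x \<bullet> x"
      proof (cases "n = 0")
        case False
        then show ?thesis
          using mult_left_mono_neg[OF le[of n] sqrt_coeff_nonpos[of n]] by simp
      qed simp
    qed
    finally show ?thesis .
  qed
  moreover have "(\<lambda>n. sqrt_coeff n *\<^sub>R op_pow X n x \<bullet> x) sums (op_series sqrt_coeff X x \<bullet> x)"
    by (rule bounded_linear.sums[OF bounded_linear_inner_left op_series_sums_apply[OF conv]])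
  ultimately show ?thesis
    by (intro LIMSEQ_le_const[of "\<lambda>m. \<Sum>n\<le>m. sqrt_coeff n *\<^sub>R op_pow X n x \<bullet> x"])
      (auto simp: sums_def_le)
qed

text \<open>
  After scaling by \<open>c > \<parallel>T\<parallel>\<close> the operator \<open>X = 1 - T / c\<close> lies between \<open>0\<close> and \<open>1\<close>, and the binomial
  series of \<open>sqrt (1 - t)\<close> at \<open>X\<close> is a root of \<open>T / c\<close>. As a limit of polynomials in \<open>T\<close> it commutes
  with the commutant of \<open>T\<close>.
\<close>

theorem positive_square_root_exists:
  fixes T :: "'h::chilbert_space \<Rightarrow>\<^sub>L 'h"
  assumes pos: "op_positive T"
  obtains R where "op_positive R" and "R o\<^sub>L R = T"
    and "\<And>S. S o\<^sub>L T = T o\<^sub>L S \<Longrightarrow> S o\<^sub>L R = R o\<^sub>L S"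
proof -
  note bb = bounded_bilinear_blinfun_compose
  note T = pos[unfolded op_positive_iff]
  define c where "c = norm T + 1"
  have c: "0 < c"
    by (simp add: c_def add_nonneg_pos)
  define X where "X = id_blinfun - (1/c) *\<^sub>R T"
  have X_apply: "X x = x - (1/c) *\<^sub>R T x" for x
    by (simp add: X_def blinfun.bilinear_simps)
  have X_mem: "X \<in> bounded_ops"
    unfolding X_def using T by (intro bounded_ops_diff bounded_ops_id bounded_ops_scaleR) simp
  have X_sa: "op_selfadjoint X"
    using T by (simp add: op_selfadjoint_def X_apply inner_simps)
  have X_pos: "0 \<le> X x \<bullet> x" for x
  proof -
    have "T x \<bullet> x \<le> norm T * (x \<bullet> x)"
      using abs_inner_blinfun_le[of T x] by (simp add: power2_norm_eq_inner)
    also have "\<dots> \<le> c * (x \<bullet> x)"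
      by (intro mult_right_mono) (simp_all add: c_def)
    finally show ?thesis
      using c by (simp add: X_apply inner_simps field_simps)
  qed
  have X_le: "X x \<bullet> x \<le> x \<bullet> x" for x
    using T c by (simp add: X_apply inner_simps)
  have norm_X: "norm X \<le> 1"
    by (rule norm_le_1_if_between[OF X_sa X_pos X_le])
  have conv: "op_series_converges sqrt_coeff X"
    unfolding op_series_converges_def
    by (rule summable_comparison_test'[OF summable_abs_sqrt_coeff])
      (use norm_X in \<open>simp add: abs_mult power_le_one mult_left_le\<close>)
  define Y where "Y = op_series sqrt_coeff X"
  define R where "R = sqrt c *\<^sub>R Y"
  have "op_selfadjoint Y"
    using op_series_adjoint[OF conv conv op_selfadjointD[OF X_sa]]
    by (simp add: Y_def op_selfadjoint_def)
  then have "op_positive R"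
    using op_series_in_bounded_ops[OF conv X_mem] op_series_sqrt_coeff_nonneg[OF norm_X conv] c
    by (simp add: op_positive_iff R_def Y_def bounded_ops_scaleR op_selfadjoint_def
        blinfun.bilinear_simps)
  moreover have "R o\<^sub>L R = T"
  proof -
    have "R o\<^sub>L R = c *\<^sub>R (Y o\<^sub>L Y)"
      using c by (simp add: R_def bounded_bilinear.scaleR_left[OF bb]
          bounded_bilinear.scaleR_right[OF bb])
    also have "Y o\<^sub>L Y = (1/c) *\<^sub>R T"
      using op_series_sqrt_coeff_square[OF conv] by (simp add: Y_def X_def)
    finally show ?thesis
      using c by simp
  qed
  moreover have "S o\<^sub>L R = R o\<^sub>L S" if S: "S o\<^sub>L T = T o\<^sub>L S" for S
  proof -
    have "S o\<^sub>L X = X o\<^sub>L S"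
      using S by (simp add: X_def bounded_bilinear.diff_left[OF bb] bounded_bilinear.diff_right[OF bb]
          bounded_bilinear.scaleR_left[OF bb] bounded_bilinear.scaleR_right[OF bb])
    then have "S o\<^sub>L Y = Y o\<^sub>L S"
      unfolding Y_def by (rule op_series_commute[OF conv])
    then show ?thesis
      by (simp add: R_def bounded_bilinear.scaleR_left[OF bb] bounded_bilinear.scaleR_right[OF bb])
  qed
  ultimately show thesis using that by blast
qed

lemma op_positive_adj_compose:
  assumes T: "T \<in> bounded_ops"
  shows "op_positive (op_adj T o\<^sub>L T)"
  using T by (simp add: op_positive_iff op_selfadjoint_def bounded_ops_compose
      op_adj_in_bounded_ops inner_op_adj_left inner_op_adj_right)

lemma
  fixes T :: "'h::chilbert_space \<Rightarrow>\<^sub>L 'h"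
  assumes T: "T \<in> bounded_ops"
  shows op_positive_op_abs: "op_positive (op_abs T)"
    and op_abs_square: "op_abs T o\<^sub>L op_abs T = op_adj T o\<^sub>L T"
    and op_abs_commute: "S o\<^sub>L (op_adj T o\<^sub>L T) = (op_adj T o\<^sub>L T) o\<^sub>L S \<Longrightarrow> S o\<^sub>L op_abs T = op_abs T o\<^sub>L S"
proof -
  obtain R where R: "op_positive R" "R o\<^sub>L R = op_adj T o\<^sub>L T"
    and comm: "\<And>S. S o\<^sub>L (op_adj T o\<^sub>L T) = (op_adj T o\<^sub>L T) o\<^sub>L S \<Longrightarrow> S o\<^sub>L R = R o\<^sub>L S"
    using positive_square_root_exists[OF op_positive_adj_compose[OF T]] by blast
  have eq: "op_abs T = R"
    unfolding op_abs_def
  proof (rule the_equality)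
    fix S :: "'h \<Rightarrow>\<^sub>L 'h"
    assume "op_positive S \<and> S o\<^sub>L S = op_adj T o\<^sub>L T"
    then show "S = R"
      using positive_square_root_unique[of S R] R by simp
  qed (use R in simp)
  show "op_positive (op_abs T)" "op_abs T o\<^sub>L op_abs T = op_adj T o\<^sub>L T"
    unfolding eq by (rule R)+
  show "S o\<^sub>L (op_adj T o\<^sub>L T) = (op_adj T o\<^sub>L T) o\<^sub>L S \<Longrightarrow> S o\<^sub>L op_abs T = op_abs T o\<^sub>L S"
    unfolding eq by (rule comm)
qed

lemma norm_op_abs_apply:
  assumes T: "T \<in> bounded_ops"
  shows "norm (op_abs T x) = norm (T x)"
proof -
  have sa: "op_selfadjoint (op_abs T)"
    using op_positive_op_abs[OF T] by (simp add: op_positive_iff)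
  have "op_abs T x \<bullet> op_abs T x = (op_abs T o\<^sub>L op_abs T) x \<bullet> x"
    using op_selfadjointD[OF sa, of "op_abs T x" x] by simp
  also have "\<dots> = T x \<bullet> T x"
    unfolding op_abs_square[OF T] by (simp add: inner_op_adj_left[OF T])
  finally show ?thesis
    by (simp add: norm_eq_sqrt_inner)
qed

section \<open>Fuglede's theorem\<close>

abbreviation op_exp :: "('a::banach \<Rightarrow>\<^sub>L 'a) \<Rightarrow> ('a \<Rightarrow>\<^sub>L 'a)"
  where "op_exp \<equiv> op_series (\<lambda>n. 1 / fact n)"

lemma op_exp_converges: "op_series_converges (\<lambda>n. 1 / fact n) T"
  using summable_exp[of "norm T"] by (simp add: op_series_converges_def inverse_eq_divide)

text \<open>
  The binomial theorem in divided form. With \<open>e\<^sub>i(R) = R\<^sup>i / i!\<close> one has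
  \<open>R e\<^sub>i(R) = (i + 1) e\<^sub>i\<^sub>+\<^sub>1(R)\<close>, so multiplying the sum for \<open>n\<close> by \<open>S\<close> and by \<open>T\<close> produces the terms for
  \<open>n + 1\<close> with weights \<open>i\<close> and \<open>n + 1 - i\<close>.
\<close>

lemma op_exp_term_add:
  assumes comm: "S o\<^sub>L T = T o\<^sub>L S"
  shows "(1 / fact n) *\<^sub>R op_pow (S + T) n
    = (\<Sum>i\<le>n. ((1 / fact i) *\<^sub>R op_pow S i) o\<^sub>L ((1 / fact (n - i)) *\<^sub>R op_pow T (n - i)))"
proof (induction n)
  case 0
  show ?case by simp
next
  case (Suc n)
  note bb = bounded_bilinear_blinfun_compose
  define e where "e R n = (1 / fact n) *\<^sub>R op_pow R n" for R :: "'a \<Rightarrow>\<^sub>L 'a" and n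
  have step: "R o\<^sub>L e R n = real (Suc n) *\<^sub>R e R (Suc n)" for R n
    by (simp add: e_def bounded_bilinear.scaleR_right[OF bb] del: of_nat_Suc)
  have T_comm: "T o\<^sub>L e S i = e S i o\<^sub>L T" for i
    using op_pow_commute[OF comm[symmetric], of i]
    by (simp add: e_def bounded_bilinear.scaleR_right[OF bb] bounded_bilinear.scaleR_left[OF bb])
  have IH: "e (S + T) n = (\<Sum>i\<le>n. e S i o\<^sub>L e T (n - i))"
    using Suc.IH by (simp only: e_def)
  have "real (Suc n) *\<^sub>R e (S + T) (Suc n) = (S + T) o\<^sub>L (\<Sum>i\<le>n. e S i o\<^sub>L e T (n - i))"
    by (simp only: IH flip: step)
  also have "\<dots> = (\<Sum>i\<le>n. (S o\<^sub>L e S i) o\<^sub>L e T (n - i)) + (\<Sum>i\<le>n. (T o\<^sub>L e S i) o\<^sub>L e T (n - i))"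
    by (simp only: bounded_bilinear.add_left[OF bb] bounded_bilinear.sum_right[OF bb] sum.distrib
        blinfun_compose_assoc)
  also have "(\<Sum>i\<le>n. (S o\<^sub>L e S i) o\<^sub>L e T (n - i))
      = (\<Sum>i\<le>n. real (Suc i) *\<^sub>R (e S (Suc i) o\<^sub>L e T (Suc n - Suc i)))"
    by (simp only: step bounded_bilinear.scaleR_left[OF bb] diff_Suc_Suc)
  also have "\<dots> = (\<Sum>i\<le>Suc n. real i *\<^sub>R (e S i o\<^sub>L e T (Suc n - i)))"
    by (subst sum.atMost_Suc_shift) simp
  also have "(\<Sum>i\<le>n. (T o\<^sub>L e S i) o\<^sub>L e T (n - i))
      = (\<Sum>i\<le>n. real (Suc n - i) *\<^sub>R (e S i o\<^sub>L e T (Suc n - i)))"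
  proof (rule sum.cong)
    fix i assume "i \<in> {..n}"
    then have "Suc n - i = Suc (n - i)" by auto
    then show "(T o\<^sub>L e S i) o\<^sub>L e T (n - i) = real (Suc n - i) *\<^sub>R (e S i o\<^sub>L e T (Suc n - i))"
      by (simp add: T_comm blinfun_compose_assoc step bounded_bilinear.scaleR_right[OF bb]
          del: of_nat_Suc)
  qed simp
  also have "\<dots> = (\<Sum>i\<le>Suc n. real (Suc n - i) *\<^sub>R (e S i o\<^sub>L e T (Suc n - i)))"
    by simp
  also have "(\<Sum>i\<le>Suc n. real i *\<^sub>R (e S i o\<^sub>L e T (Suc n - i)))
        + (\<Sum>i\<le>Suc n. real (Suc n - i) *\<^sub>R (e S i o\<^sub>L e T (Suc n - i)))
      = (\<Sum>i\<le>Suc n. real (Suc n) *\<^sub>R (e S i o\<^sub>L e T (Suc n - i)))"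
    unfolding sum.distrib[symmetric]
    by (rule sum.cong) (auto simp: of_nat_diff simp flip: scaleR_add_left)
  also have "\<dots> = real (Suc n) *\<^sub>R (\<Sum>i\<le>Suc n. e S i o\<^sub>L e T (Suc n - i))"
    by (rule scaleR_right.sum[symmetric])
  finally have "e (S + T) (Suc n) = (\<Sum>i\<le>Suc n. e S i o\<^sub>L e T (Suc n - i))"
    by (rule scaleR_left_imp_eq[rotated]) simp
  then show ?case
    unfolding e_def .
qed

lemma op_exp_add:
  assumes "S o\<^sub>L T = T o\<^sub>L S"
  shows "op_exp (S + T) = op_exp S o\<^sub>L op_exp T"
  using op_series_mult[OF op_exp_converges[of S] op_exp_converges[of T]]
    op_series_sums[OF op_exp_converges[of "S + T"]]
  unfolding op_exp_term_add[OF assms] by (rule sums_unique2[rotated])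

lemma op_exp_zero: "op_exp 0 = id_blinfun"
proof -
  have "op_pow (0 :: 'a \<Rightarrow>\<^sub>L 'a) n = 0" if "n \<noteq> 0" for n
    using that by (cases n) auto
  then have "(\<lambda>n. (1 / fact n) *\<^sub>R op_pow (0 :: 'a \<Rightarrow>\<^sub>L 'a) n)
      sums (\<Sum>n\<in>{0}. (1 / fact n) *\<^sub>R op_pow (0 :: 'a \<Rightarrow>\<^sub>L 'a) n)"
    by (intro sums_finite) auto
  with op_series_sums[OF op_exp_converges[of 0]] show ?thesis
    using sums_unique2 by fastforce
qed

lemma op_exp_minus: "op_exp (- T) o\<^sub>L op_exp T = id_blinfun" "op_exp T o\<^sub>L op_exp (- T) = id_blinfun"
proof -
  note bb = bounded_bilinear_blinfun_compose
  have "- T o\<^sub>L T = T o\<^sub>L - T"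
    by (simp add: bounded_bilinear.minus_left[OF bb] bounded_bilinear.minus_right[OF bb])
  from op_exp_add[OF this] op_exp_add[OF this[symmetric]]
  show "op_exp (- T) o\<^sub>L op_exp T = id_blinfun" "op_exp T o\<^sub>L op_exp (- T) = id_blinfun"
    by (simp_all add: op_exp_zero)
qed

text \<open>
  The adjoint of \<open>exp K\<close> is \<open>exp (- K)\<close>, its inverse.
\<close>

lemma norm_op_exp_skew:
  fixes K :: "'a::{real_inner, banach} \<Rightarrow>\<^sub>L 'a"
  assumes skew: "\<And>x y. K x \<bullet> y = - (x \<bullet> K y)"
  shows "norm (op_exp K x) = norm x"
proof -
  have "op_exp K x \<bullet> op_exp K x = x \<bullet> op_exp (- K) (op_exp K x)"
    by (rule op_series_adjoint[OF op_exp_converges op_exp_converges])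
      (simp add: skew blinfun.bilinear_simps)
  also have "op_exp (- K) (op_exp K x) = x"
    using op_exp_minus(1)[of K] by (metis blinfun_apply_blinfun_compose blinfun_apply_id_blinfun)
  finally show ?thesis
    by (simp add: norm_eq_sqrt_inner)
qed

text \<open>
  Liouville's theorem in the form in which it is applied: the coefficient of \<open>z\<close> is the
  derivative at \<open>0\<close> of a constant function.
\<close>

lemma bounded_entire_power_series_coeff:
  fixes f :: "complex \<Rightarrow> complex"
  assumes sums: "\<And>z. (\<lambda>n. a n * z ^ n) sums f z" and bound: "\<And>z. cmod (f z) \<le> M"
  shows "a 1 = 0"
proof -
  have deriv: "\<exists>d. (f has_field_derivative d) (at z) \<and> (\<lambda>n. of_nat n * a n * z ^ (n - 1)) sums d" for z
  proof -
    have "summable (\<lambda>n. a n * complex_of_real (cmod z + 1) ^ n)"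
      using sums by (rule sums_summable)
    then obtain g g' where g: "\<And>w. cmod w < cmod z + 1 \<Longrightarrow> (\<lambda>n. a n * w ^ n) sums g w \<and>
        (\<lambda>n. of_nat n * a n * w ^ (n - 1)) sums g' w \<and> (g has_field_derivative g' w) (at w)"
      using power_series_and_derivative_0[of a "cmod z + 1"] by auto
    have "(f has_field_derivative g' z) (at z)"
    proof (rule has_field_derivative_transform_within_open)
      show "(g has_field_derivative g' z) (at z)"
        using g[of z] by simp
      show "g w = f w" if "w \<in> ball 0 (cmod z + 1)" for w
        using g[of w] sums[of w] that sums_unique2 by auto
    qed auto
    then show ?thesis
      using g[of z] by auto
  qed
  have "f holomorphic_on UNIV"
    using deriv by (meson holomorphic_on_open open_UNIV)
  moreover have "bounded (range f)"
    using bound by (auto simp: bounded_iff)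
  ultimately have "f constant_on UNIV"
    by (rule Liouville_theorem)
  then obtain c where "f = (\<lambda>z. c)"
    by (auto simp: constant_on_def)
  moreover obtain d where d: "(f has_field_derivative d) (at 0)"
    "(\<lambda>n. of_nat n * a n * 0 ^ (n - 1)) sums d"
    using deriv by blast
  ultimately have "d = 0"
    using DERIV_unique DERIV_const by blast
  moreover have "(\<lambda>n. of_nat n * a n * 0 ^ (n - 1)) sums (\<Sum>n\<in>{1}. of_nat n * a n * 0 ^ (n - 1))"
    by (rule sums_finite) auto
  ultimately show ?thesis
    using d(2) sums_unique2 by fastforce
qed

lemma op_pow_in_bounded_ops: "T \<in> bounded_ops \<Longrightarrow> op_pow T n \<in> bounded_ops"
  by (induction n) (simp_all add: bounded_ops_id bounded_ops_compose)

lemma op_pow_scaleC: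
  assumes T: "T \<in> bounded_ops"
  shows "op_pow (scaleC_op z o\<^sub>L T) n x = z ^ n *\<^sub>C op_pow T n x"
  by (induction n) (simp_all add: bounded_opsD[OF T] scaleC_one scaleC_scaleC)

text \<open>
  Rosenblum's argument. Put \<open>F(z) = exp (z A\<^sup>*) B exp (- z A\<^sup>*)\<close>. Since \<open>B\<close> commutes with
  \<open>exp (cnj z A)\<close> and \<open>A\<close> is normal, \<open>F(z)\<close> equals \<open>exp K B exp (- K)\<close> for the skew-adjoint operator
  \<open>K = z A\<^sup>* - cnj z A\<close>, so that \<open>\<parallel>F(z)\<parallel> \<le> \<parallel>B\<parallel>\<close>. The matrix coefficients of \<open>F\<close> are bounded entire
  functions, and their linear coefficients are those of \<open>A\<^sup>* B - B A\<^sup>*\<close>.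
\<close>

theorem fuglede:
  fixes A B :: "'h::chilbert_space \<Rightarrow>\<^sub>L 'h"
  assumes A: "A \<in> bounded_ops" and B: "B \<in> bounded_ops"
    and comm: "A o\<^sub>L B = B o\<^sub>L A" and normal: "op_normal A"
  shows "op_adj A o\<^sub>L B = B o\<^sub>L op_adj A"
proof -
  note bb = bounded_bilinear_blinfun_compose
  define N where "N = op_adj A"
  have N: "N \<in> bounded_ops" and mN: "- N \<in> bounded_ops"
    using op_adj_in_bounded_ops[OF A] by (auto simp: N_def bounded_ops_uminus)
  define P where "P z = scaleC_op z o\<^sub>L N" for z
  define Q where "Q z = scaleC_op (cnj z) o\<^sub>L A" for z
  define F where "F z = op_exp (P z) o\<^sub>L (B o\<^sub>L op_exp (- P z))" for z
  have P_apply: "P z x = z *\<^sub>C N x" and Q_apply: "Q z x = cnj z *\<^sub>C A x" for z x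
    by (simp_all add: P_def Q_def)
  have AN: "A (N x) = N (A x)" for x
    using normal compose_commute_apply[of A N] by (simp add: op_normal_def N_def)
  have AB: "A (B x) = B (A x)" for x
    using comm by (rule compose_commute_apply)
  have PQ: "P z o\<^sub>L Q z = Q z o\<^sub>L P z" for z
    by (rule blinfun_eqI)
      (simp add: P_apply Q_apply bounded_opsD[OF A] bounded_opsD[OF N] AN scaleC_scaleC mult.commute)
  have BQ: "B o\<^sub>L Q z = Q z o\<^sub>L B" for z
    by (rule blinfun_eqI) (simp add: Q_apply bounded_opsD[OF B] AB)
  have bound: "norm (F z x) \<le> norm B * norm x" for z x
  proof -
    define K where "K = P z - Q z"
    have adj: "P z x \<bullet> y = x \<bullet> Q z y" for x y
      by (simp add: P_apply Q_apply inner_scaleC_left N_def inner_op_adj_left[OF A] bounded_opsD[OF A])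
    have adj': "Q z x \<bullet> y = x \<bullet> P z y" for x y
      by (metis adj inner_commute)
    have skew: "K x \<bullet> y = - (x \<bullet> K y)" for x y
      by (simp add: K_def blinfun.diff_left inner_diff_left inner_diff_right adj adj')
    have skew': "(- K) x \<bullet> y = - (x \<bullet> (- K) y)" for x y
      by (simp add: skew blinfun.bilinear_simps)
    have eK: "op_exp K = op_exp (P z) o\<^sub>L op_exp (- Q z)"
      unfolding K_def diff_conv_add_uminus
      by (rule op_exp_add)
        (simp add: PQ bounded_bilinear.minus_left[OF bb] bounded_bilinear.minus_right[OF bb])
    have "- K = Q z + - P z"
      by (simp add: K_def)
    then have emK: "op_exp (- K) = op_exp (Q z) o\<^sub>L op_exp (- P z)"
      by (simp only:, intro op_exp_add)
        (simp add: PQ bounded_bilinear.minus_left[OF bb] bounded_bilinear.minus_right[OF bb])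
    \<comment> \<open>\<open>B\<close> commutes with \<open>exp (cnj z A)\<close>, so conjugation by the unitary \<open>exp K\<close> has the same effect
      as conjugation by \<open>exp (z A\<^sup>*)\<close>.\<close>
    have "op_exp (- Q z) o\<^sub>L (B o\<^sub>L op_exp (Q z)) = op_exp (- Q z) o\<^sub>L (op_exp (Q z) o\<^sub>L B)"
      by (simp add: op_series_commute[OF op_exp_converges BQ])
    also have "\<dots> = B"
      by (simp add: op_exp_minus flip: blinfun_compose_assoc)
    finally have "F z = op_exp K o\<^sub>L (B o\<^sub>L op_exp (- K))"
      unfolding F_def eK emK by (metis blinfun_compose_assoc)
    then have "norm (F z x) = norm (B (op_exp (- K) x))"
      by (simp add: norm_op_exp_skew[OF skew])
    also have "\<dots> \<le> norm B * norm (op_exp (- K) x)"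
      by (rule norm_blinfun)
    finally show ?thesis
      by (simp add: norm_op_exp_skew[OF skew'])
  qed
  have "N (B x) = B (N x)" for x
  proof (rule eq_if_inner_eq)
    fix y
    define c where "c i j = op_pow N i (B (op_pow (- N) j x))" for i j
    define a where "a k = (\<Sum>i\<le>k. (1 / (fact i * fact (k - i))) * cinner (c i (k - i)) y)" for k
    have sums: "(\<lambda>k. a k * z ^ k) sums cinner (F z x) y" for z
    proof -
      define p where "p i = (1 / fact i) *\<^sub>R op_pow (P z) i" for i
      define q where "q i = B o\<^sub>L ((1 / fact i) *\<^sub>R op_pow (- P z) i)" for i
      have p: "summable (\<lambda>i. norm (p i))" "p sums op_exp (P z)"
        unfolding p_def[abs_def]
        by (rule op_series_summable_norm op_series_sums; rule op_exp_converges)+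
      have "summable (\<lambda>i. norm B * norm ((1 / fact i) *\<^sub>R op_pow (- P z) i))"
        by (intro summable_mult op_series_summable_norm op_exp_converges)
      then have q: "summable (\<lambda>i. norm (q i))"
        by (rule summable_comparison_test') (simp only: q_def real_norm_def abs_norm_cancel norm_blinfun_compose)
      have q': "q sums (B o\<^sub>L op_exp (- P z))"
        unfolding q_def[abs_def]
        by (rule bounded_linear.sums[OF bounded_bilinear.bounded_linear_right[OF bb]
              op_series_sums[OF op_exp_converges]])
      have "(\<lambda>k. \<Sum>i\<le>k. p i o\<^sub>L q (k - i)) sums F z"
        unfolding F_def by (rule bounded_bilinear.Cauchy_product_sums[OF bb p(1) q p(2) q'])
      moreover have "bounded_linear (\<lambda>S. cinner (blinfun_apply S x) y)"
        by (rule bounded_linear_compose[OF bounded_linear_cinner_left blinfun.bounded_linear_left])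
      ultimately have "(\<lambda>k. cinner ((\<Sum>i\<le>k. p i o\<^sub>L q (k - i)) x) y) sums cinner (F z x) y"
        by (rule bounded_linear.sums[rotated])
      moreover have "cinner ((\<Sum>i\<le>k. p i o\<^sub>L q (k - i)) x) y = a k * z ^ k" for k
      proof -
        have powP: "op_pow (P z) i u = z ^ i *\<^sub>C op_pow N i u"
          "op_pow (- P z) i u = z ^ i *\<^sub>C op_pow (- N) i u" for i u
          using op_pow_scaleC[OF N] op_pow_scaleC[OF mN]
          by (simp_all add: P_def bounded_bilinear.minus_right[OF bb])
        have pq: "(p i o\<^sub>L q j) x = (z ^ (i + j) / (fact i * fact j)) *\<^sub>C c i j" for i j
        proof -
          have "(p i o\<^sub>L q j) x = (1 / fact i) *\<^sub>R (z ^ i *\<^sub>C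
              op_pow N i (B ((1 / fact j) *\<^sub>R (z ^ j *\<^sub>C op_pow (- N) j x))))"
            by (simp only: p_def q_def powP blinfun_apply_blinfun_compose blinfun.scaleR_left)
          also have "\<dots> = (of_real (1 / fact i) * (z ^ i * (of_real (1 / fact j) * z ^ j))) *\<^sub>C c i j"
            by (simp only: scaleR_scaleC bounded_opsD[OF B] bounded_opsD[OF op_pow_in_bounded_ops[OF N]]
                scaleC_scaleC c_def)
          also have "of_real (1 / fact i) * (z ^ i * (of_real (1 / fact j) * z ^ j))
              = z ^ (i + j) / (fact i * fact j)"
            by (simp add: power_add)
          finally show ?thesis .
        qed
        have "cinner ((\<Sum>i\<le>k. p i o\<^sub>L q (k - i)) x) y = (\<Sum>i\<le>k. cinner ((p i o\<^sub>L q (k - i)) x) y)"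
          by (simp only: blinfun.sum_left linear_sum[OF bounded_linear.linear[OF bounded_linear_cinner_left]])
        also have "\<dots> = (\<Sum>i\<le>k. (1 / (fact i * fact (k - i))) * cinner (c i (k - i)) y * z ^ k)"
          by (rule sum.cong) (simp_all only: pq cinner_scaleC_left, simp)
        also have "\<dots> = a k * z ^ k"
          by (simp add: a_def sum_distrib_right)
        finally show ?thesis .
      qed
      ultimately show ?thesis by simp
    qed
    have "cmod (cinner (F z x) y) \<le> norm B * norm x * norm y" for z
      by (rule order_trans[OF norm_cinner_le]) (intro mult_right_mono bound norm_ge_zero)
    with sums have "a 1 = 0"
      by (rule bounded_entire_power_series_coeff)
    then have "Re (cinner (B (- N x)) y + cinner (N (B x)) y) = 0"
      by (simp add: a_def c_def blinfun.minus_left)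
    then show "y \<bullet> N (B x) = y \<bullet> B (N x)"
      by (simp add: blinfun.minus_right inner_commute flip: inner_eq_Re_cinner)
  qed
  then show ?thesis
    by (intro blinfun_eqI) (simp add: N_def)
qed

section \<open>The triangle inequality\<close>

theorem theorem3p4:
  fixes A B :: "'h::chilbert_space \<Rightarrow>\<^sub>L 'h"
  assumes "A \<in> bounded_ops" and "B \<in> bounded_ops"
    and "A o\<^sub>L B = B o\<^sub>L A"
    and "op_normal A" and "op_hyponormal B"
  shows "op_abs (A + B) \<le>\<^sub>o\<^sub>p op_abs A + op_abs B"
proof -
  note A = assms(1) and B = assms(2) and comm = assms(3) and normal = assms(4) and hypo = assms(5)
  have AB: "A + B \<in> bounded_ops"
    using A B by (rule bounded_ops_add)
  define A' B' where "A' = op_adj A" and "B' = op_adj B"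
  note adjA = inner_op_adj_left[OF A, folded A'_def] inner_op_adj_right[OF A, folded A'_def]
  note adjB = inner_op_adj_left[OF B, folded B'_def] inner_op_adj_right[OF B, folded B'_def]
  have cAB: "A (B x) = B (A x)" for x
    using comm by (rule compose_commute_apply)
  have cA'B: "A' (B x) = B (A' x)" for x
    unfolding A'_def using fuglede[OF A B comm normal] by (rule compose_commute_apply)
  have cAB': "A (B' x) = B' (A x)" for x
    by (rule eq_if_inner_eq) (metis adjA adjB cA'B)
  have cA'B': "A' (B' x) = B' (A' x)" for x
    by (rule eq_if_inner_eq) (metis adjA adjB cAB)
  have normA: "norm (A' x) = norm (A x)" for x
  proof -
    have "A (A' x) = A' (A x)"
      using normal compose_commute_apply[of A A'] by (simp add: op_normal_def A'_def)
    then have "A' x \<bullet> A' x = A x \<bullet> A x"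
      by (metis adjA)
    then show ?thesis by (simp add: norm_eq_sqrt_inner)
  qed
  have normB: "norm (B' x) \<le> norm (B x)" for x
  proof -
    have "0 \<le> (B' (B x) - B (B' x)) \<bullet> x"
      using hypo by (simp add: op_hyponormal_def op_le_def op_positive_iff B'_def blinfun.diff_left)
    then have "B' x \<bullet> B' x \<le> B x \<bullet> B x"
      by (simp add: inner_diff_left adjB)
    then show ?thesis by (simp add: norm_eq_sqrt_inner)
  qed
  define P Q N where "P = op_abs A" and "Q = op_abs B" and "N = op_abs (A + B)"
  have P: "op_positive P" "P \<in> bounded_ops" "op_selfadjoint P" "\<And>x. 0 \<le> P x \<bullet> x"
    and Q: "op_positive Q" "Q \<in> bounded_ops" "op_selfadjoint Q" "\<And>x. 0 \<le> Q x \<bullet> x"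
    and N: "op_positive N" "N \<in> bounded_ops" "op_selfadjoint N"
    using op_positive_op_abs[OF A] op_positive_op_abs[OF B] op_positive_op_abs[OF AB]
    by (auto simp: op_positive_iff P_def Q_def N_def)
  have normP: "norm (P x) = norm (A x)" and normQ: "norm (Q x) = norm (B x)"
    and normN: "norm (N x) = norm (A x + B x)" for x
    using norm_op_abs_apply[OF A] norm_op_abs_apply[OF B] norm_op_abs_apply[OF AB]
    by (simp_all add: P_def Q_def N_def blinfun.add_left)
  have BP: "B o\<^sub>L P = P o\<^sub>L B"
    unfolding P_def by (rule op_abs_commute[OF A], rule blinfun_eqI)
      (simp add: cAB cA'B flip: A'_def)
  have B'P: "B' o\<^sub>L P = P o\<^sub>L B'"
    unfolding P_def by (rule op_abs_commute[OF A], rule blinfun_eqI)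
      (simp add: cAB' cA'B' flip: A'_def)
  have cBP: "B (P x) = P (B x)" and cB'P: "B' (P x) = P (B' x)" for x
    by (rule compose_commute_apply[OF BP], rule compose_commute_apply[OF B'P])
  have PQ: "P o\<^sub>L Q = Q o\<^sub>L P"
    unfolding Q_def by (rule op_abs_commute[OF B], rule blinfun_eqI)
      (simp add: cBP cB'P flip: B'_def)
  have cPQ: "P (Q x) = Q (P x)" for x
    using PQ by (rule compose_commute_apply)
  define W where "W = P o\<^sub>L Q"
  have W_sa: "op_selfadjoint W"
    unfolding op_selfadjoint_def W_def
    using op_selfadjointD[OF P(3)] op_selfadjointD[OF Q(3)] by (simp add: cPQ)
  have W_pos: "0 \<le> W x \<bullet> x" for x
  proof -
    \<comment> \<open>The root \<open>R\<close> of \<open>P\<close> commutes with \<open>Q\<close>, so the form of \<open>P Q\<close> at \<open>x\<close> is that of \<open>Q\<close> at \<open>R x\<close>.\<close>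
    obtain R where R: "op_positive R" "R o\<^sub>L R = P" "\<And>S. S o\<^sub>L P = P o\<^sub>L S \<Longrightarrow> S o\<^sub>L R = R o\<^sub>L S"
      using positive_square_root_exists[OF P(1)] by blast
    have "W x \<bullet> x = R (R (Q x)) \<bullet> x"
      using R(2) by (auto simp: W_def)
    also have "\<dots> = R (Q x) \<bullet> R x"
      using R(1) by (simp add: op_positive_iff op_selfadjoint_def)
    also have "R (Q x) = Q (R x)"
      by (rule compose_commute_apply[OF R(3)[OF PQ[symmetric]], symmetric])
    finally show ?thesis
      using Q(4) by simp
  qed
  \<comment> \<open>The real part of \<open>A\<^sup>* B\<close>, whose form is the cross term.\<close>
  define H where "H = (1/2) *\<^sub>R ((A' o\<^sub>L B) + (B' o\<^sub>L A))"
  have H_apply: "H x = (1/2) *\<^sub>R (A' (B x) + B' (A x))" for x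
    by (simp add: H_def blinfun.scaleR_left blinfun.add_left)
  have H_sa: "op_selfadjoint H"
    by (simp add: op_selfadjoint_def H_apply inner_add_left inner_add_right adjA adjB)
  have H_le: "norm (H x) \<le> norm (W x)" for x
  proof -
    have "norm (B' (A x)) \<le> norm (A (B x))"
      using normB[of "A x"] by (simp add: cAB)
    then have "norm (A' (B x) + B' (A x)) \<le> 2 * norm (A (B x))"
      using norm_triangle_ineq[of "A' (B x)" "B' (A x)"] by (simp add: normA)
    also have "norm (A (B x)) = norm (W x)"
      by (metis W_def blinfun_apply_blinfun_compose cBP cPQ normP normQ)
    finally show ?thesis
      by (simp add: H_apply)
  qed
  have cross: "A x \<bullet> B x \<le> P x \<bullet> Q x" for x
  proof -
    have "A x \<bullet> B x = H x \<bullet> x"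
      by (simp add: H_apply inner_add_left adjA(1) adjB(1) inner_commute[of "B x"])
    also have "\<dots> \<le> W x \<bullet> x"
      by (rule inner_le_if_norm_le[OF H_sa W_sa W_pos H_le])
    also have "\<dots> = P x \<bullet> Q x"
      using op_selfadjointD[OF P(3), of "Q x" x] by (simp add: W_def inner_commute)
    finally show ?thesis .
  qed
  have PQ_sa: "op_selfadjoint (P + Q)"
    using P(3) Q(3) by (simp add: op_selfadjoint_def blinfun.add_left inner_add_left inner_add_right)
  have "norm (N x) \<le> norm ((P + Q) x)" for x
  proof (rule power2_le_imp_le)
    have "(norm (N x))\<^sup>2 = (norm (A x))\<^sup>2 + 2 * (A x \<bullet> B x) + (norm (B x))\<^sup>2"
      by (simp add: normN power2_norm_eq_inner inner_add_left inner_add_right inner_commute)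
    also have "\<dots> \<le> (norm (P x))\<^sup>2 + 2 * (P x \<bullet> Q x) + (norm (Q x))\<^sup>2"
      using cross by (simp add: normP normQ)
    also have "\<dots> = (norm ((P + Q) x))\<^sup>2"
      by (simp add: blinfun.add_left power2_norm_eq_inner inner_add_left inner_add_right inner_commute)
    finally show "(norm (N x))\<^sup>2 \<le> (norm ((P + Q) x))\<^sup>2" .
  qed simp
  then have "N x \<bullet> x \<le> (P + Q) x \<bullet> x" for x
    using P(4) Q(4)
    by (intro inner_le_if_norm_le[OF N(3) PQ_sa]) (auto simp: blinfun.add_left inner_add_left)
  then have "op_positive (P + Q - N)"
    using P Q N PQ_sa
    by (auto simp: op_positive_iff op_selfadjoint_def blinfun.diff_left inner_diff_left inner_diff_right
        intro: bounded_ops_diff bounded_ops_add)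
  then show ?thesis
    by (simp add: op_le_def P_def Q_def N_def)
qed

end
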